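(* A decomposable $7$-dimensional real nilpotent Lie algebra (i.e. one that is a direct sum of two nonzero ideals) admits a calibrated $\mathrm{G}_2$-structure if and only if it is isomorphic to one of $(0,0,0,0,0,0,0)$, $(0,0,0,0,12,13,0)$, $(0,0,0,12,13,23,0)$.
   Context: Notation: $(a_1,\dots,a_n)$ denotes the Lie algebra having a basis $e^1,\dots,e^n$ of its dual with $de^i=a_i$, where e.g. "$12$" stands for $e^{12}=e^1\wedge e^2$; $d$ is the Chevalley–Eilenberg differential. A $3$-form $\varphi\in\Lambda^3\mathfrak g^*$ on a $7$-dimensional Lie algebra defines a $\mathrm{G}_2$-structure if there is a basis $f^1,\dots,f^7$ of $\mathfrak g^*$ with $\varphi=f^{127}+f^{347}+f^{567}+f^{135}-f^{236}-f^{146}-f^{245}$ (where $f^{ijk}=f^i\wedge f^j\wedge f^k$); the $\mathrm{G}_2$-structure is calibrated if $d\varphi=0$. *)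

theory Defs
  imports "HOL-Analysis.Analysis"
begin

definition lie_algebra :: "('a::real_vector \<Rightarrow> 'a \<Rightarrow> 'a) \<Rightarrow> bool" where
  "lie_algebra br \<longleftrightarrow>
     (\<forall>x. linear (br x)) \<and> (\<forall>y. linear (\<lambda>x. br x y)) \<and>
     (\<forall>x. br x x = 0) \<and>
     (\<forall>x y z. br x (br y z) + br y (br z x) + br z (br x y) = 0)"

fun lower_central :: "('a::real_vector \<Rightarrow> 'a \<Rightarrow> 'a) \<Rightarrow> nat \<Rightarrow> 'a set" where
  "lower_central br 0 = UNIV"
| "lower_central br (Suc k) = span {br x y | x y. y \<in> lower_central br k}"

definition nilpotent_lie :: "('a::real_vector \<Rightarrow> 'a \<Rightarrow> 'a) \<Rightarrow> bool" where
  "nilpotent_lie br \<longleftrightarrow> (\<exists>k. lower_central br k = {0})"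

definition lie_ideal :: "('a::real_vector \<Rightarrow> 'a \<Rightarrow> 'a) \<Rightarrow> 'a set \<Rightarrow> bool" where
  "lie_ideal br I \<longleftrightarrow> subspace I \<and> (\<forall>x y. y \<in> I \<longrightarrow> br x y \<in> I)"

definition decomposable_lie :: "('a::real_vector \<Rightarrow> 'a \<Rightarrow> 'a) \<Rightarrow> bool" where
  "decomposable_lie br \<longleftrightarrow>
     (\<exists>I J. lie_ideal br I \<and> lie_ideal br J \<and> I \<noteq> {0} \<and> J \<noteq> {0} \<and>
            I \<inter> J = {0} \<and> (\<forall>v. \<exists>a\<in>I. \<exists>b\<in>J. v = a + b))"

definition lie_iso :: "('a::real_vector \<Rightarrow> 'a \<Rightarrow> 'a) \<Rightarrow> ('b::real_vector \<Rightarrow> 'b \<Rightarrow> 'b) \<Rightarrow> bool" where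
  "lie_iso br br' \<longleftrightarrow>
     (\<exists>f::'a \<Rightarrow> 'b. linear f \<and> bij f \<and> (\<forall>x y. f (br x y) = br' (f x) (f y)))"

text \<open>f^{ijk}(x,y,z) = det (f^a(x_b)) for a in {i,j,k}.\<close>
definition wedge3 :: "(nat \<Rightarrow> 'a \<Rightarrow> real) \<Rightarrow> nat \<Rightarrow> nat \<Rightarrow> nat \<Rightarrow> 'a \<Rightarrow> 'a \<Rightarrow> 'a \<Rightarrow> real" where
  "wedge3 f i j k x y z =
       f i x * f j y * f k z - f i x * f k y * f j z
     - f j x * f i y * f k z + f j x * f k y * f i z
     + f k x * f i y * f j z - f k x * f j y * f i z"

definition g2_form :: "(nat \<Rightarrow> 'a \<Rightarrow> real) \<Rightarrow> 'a \<Rightarrow> 'a \<Rightarrow> 'a \<Rightarrow> real" where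
  "g2_form f x y z =
       wedge3 f 1 2 7 x y z + wedge3 f 3 4 7 x y z + wedge3 f 5 6 7 x y z
     + wedge3 f 1 3 5 x y z - wedge3 f 2 3 6 x y z - wedge3 f 1 4 6 x y z
     - wedge3 f 2 4 5 x y z"

definition dual_basis7 :: "(nat \<Rightarrow> 'a::real_vector \<Rightarrow> real) \<Rightarrow> bool" where
  "dual_basis7 f \<longleftrightarrow> (\<forall>i\<in>{1..7}. linear (f i)) \<and>
     (\<forall>c::nat \<Rightarrow> real. (\<forall>x. (\<Sum>i=1..7. c i * f i x) = 0) \<longrightarrow> (\<forall>i\<in>{1..7}. c i = 0))"

definition G2_structure :: "('a::real_vector \<Rightarrow> 'a \<Rightarrow> 'a \<Rightarrow> real) \<Rightarrow> bool" where
  "G2_structure \<phi> \<longleftrightarrow> (\<exists>f. dual_basis7 f \<and> (\<forall>x y z. \<phi> x y z = g2_form f x y z))"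

text \<open>Chevalley--Eilenberg differential of a 3-form:
  d phi(x0,x1,x2,x3) = sum_{i<j} (-1)^(i+j) phi([xi,xj], ...).\<close>
definition ce_d3 :: "('a \<Rightarrow> 'a \<Rightarrow> 'a) \<Rightarrow> ('a \<Rightarrow> 'a \<Rightarrow> 'a \<Rightarrow> real) \<Rightarrow> 'a \<Rightarrow> 'a \<Rightarrow> 'a \<Rightarrow> 'a \<Rightarrow> real" where
  "ce_d3 br \<phi> a b c e =
       - \<phi> (br a b) c e + \<phi> (br a c) b e - \<phi> (br a e) b c
     - \<phi> (br b c) a e + \<phi> (br b e) a c - \<phi> (br c e) a b"

definition has_calibrated_G2 :: "('a::real_vector \<Rightarrow> 'a \<Rightarrow> 'a) \<Rightarrow> bool" where
  "has_calibrated_G2 br \<longleftrightarrow>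
     (\<exists>\<phi>. G2_structure \<phi> \<and> (\<forall>a b c e. ce_d3 br \<phi> a b c e = 0))"

text \<open>Basis e_1..e_7 of real^7 (index type 7 has elements 0..6).\<close>
definition eb :: "nat \<Rightarrow> real^7" where
  "eb k = axis (of_nat (k - 1) :: 7) 1"

definition crd :: "real^7 \<Rightarrow> nat \<Rightarrow> real" where
  "crd x k = x $ (of_nat (k - 1) :: 7)"

text \<open>Given D k i j = coefficient of e^{ij} (i<j) in de^k, the bracket is
  determined by de^k(x,y) = - e^k([x,y]).\<close>
definition lie_of_d :: "(nat \<Rightarrow> nat \<Rightarrow> nat \<Rightarrow> real) \<Rightarrow> real^7 \<Rightarrow> real^7 \<Rightarrow> real^7" where
  "lie_of_d D x y = (\<Sum>k=1..7. (- (\<Sum>i=1..7. \<Sum>j=1..7.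
        if i < j then D k i j * (crd x i * crd y j - crd x j * crd y i) else 0)) *\<^sub>R eb k)"

definition model0 :: "real^7 \<Rightarrow> real^7 \<Rightarrow> real^7" where
  "model0 = lie_of_d (\<lambda>k i j. 0)"

definition model1 :: "real^7 \<Rightarrow> real^7 \<Rightarrow> real^7" where
  "model1 = lie_of_d (\<lambda>k i j. of_bool ((k,i,j) = (5,1,2) \<or> (k,i,j) = (6,1,3)))"

definition model2 :: "real^7 \<Rightarrow> real^7 \<Rightarrow> real^7" where
  "model2 = lie_of_d (\<lambda>k i j. of_bool ((k,i,j) = (4,1,2) \<or> (k,i,j) = (5,1,3) \<or> (k,i,j) = (6,2,3)))"

end

theory Submission
  imports Defs
begin

text \<open>The contradictions rest on one count: for Z \<noteq> 0 the 2-form \<phi>(Z, \<cdot>,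
  \<cdot>) has kernel exactly \<langle>Z\<rangle>, so \<phi>(Z, U, V) = 0 forces dim U + dim V \<le>
  8. The role of T is to enlarge D to M = D + \<langle>T\<rangle>: for Z central and [Y, \<cdot>] in
  \<langle>Z\<rangle>, both \<phi>(Z, T, \<cdot>) and \<phi>(Z, Y, \<cdot>) vanish on M. This
  settles dim D \<ge> 5 at once. The obstacle is the smaller dimensions, where M alone does not
  violate the bound. There the brackets of the flag members are written with linear functionals;
  closedness makes these proportional to contractions of \<phi>, and the Jacobi identity supplies
  the remaining relations. The inner product in the dimension counts is that of the ambient
  Euclidean space, not the metric induced by \<phi>.

  The models appear because a central D leaves little freedom: for dim D = 3, M is central of
  codimension 3, so three generators must have three independent brackets; for dim D = 2, the kernel
  of \<phi>(Z, Y, \<cdot>) is an abelian hyperplane and a single operator of rank 2 remains.\<close>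

text \<open>
  A G2-form \<open>\<phi>\<close> has an injective cross product: if \<open>\<phi>(x, y, \<cdot>) = 0\<close> then x and y are
  linearly dependent. If both factors of a decomposition were nonabelian, closedness of \<open>\<phi>\<close> would give
  \<open>\<phi>(Z\<^sub>1, Z\<^sub>2, \<cdot>) = 0\<close> for central \<open>Z\<^sub>1, Z\<^sub>2\<close> in the two derived algebras; hence there is a central T
  outside the derived algebra D. Contracting \<open>\<phi>\<close> with T and with the first members of a flag
  \<open>\<langle>Z\<rangle> \<subset> \<langle>Y, Z\<rangle> \<subset> \<dots>\<close> of ideals of D gives closed 2-forms with large isotropic subspaces, which
  contradicts injectivity unless D is central of dimension 0, 2 or 3. These three cases are the
  three models. Conversely each model carries an explicit closed G2-form, which is pulled back along the isomorphism.
\<close>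

section \<open>Closed G2-forms on the models\<close>

lemma atLeastAtMost_1_7: "{1..7::nat} = {1,2,3,4,5,6,7}"
  by auto

lemma sum_1_7:
  fixes h :: "nat \<Rightarrow> 'b::comm_monoid_add"
  shows "(\<Sum>i=1..7. h i) = h 1 + h 2 + h 3 + h 4 + h 5 + h 6 + h 7"
  unfolding atLeastAtMost_1_7 by (simp add: add.assoc)

lemma crd_simps [simp]:
  "crd (x + y) k = crd x k + crd y k" "crd (c *\<^sub>R x) k = c * crd x k" "crd 0 k = 0"
  by (simp_all add: crd_def)

lemma index_type_7_cases: "\<exists>k\<in>{1..7}. i = (of_nat (k - 1) :: 7)"
proof -
  obtain z where "i = of_int z" "0 \<le> z" "z < 7"
    by (cases i rule: bit1.cases) auto
  then show ?thesis by (intro bexI[of _ "nat z + 1"]) auto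
qed

lemma crd_eb:
  assumes "i \<in> {1..7}" "j \<in> {1..7}"
  shows "crd (eb i) j = of_bool (i = j)"
  using assms unfolding atLeastAtMost_1_7 crd_def eb_def by (auto simp: axis_def)

lemma crd_eqI:
  assumes "\<And>k. k \<in> {1..7} \<Longrightarrow> crd x k = crd y k"
  shows "x = y"
proof -
  have "x $ i = y $ i" for i
    using index_type_7_cases[of i] assms by (metis crd_def)
  then show ?thesis by (simp add: vec_eq_iff)
qed

lemma crd_sum_eb:
  assumes "j \<in> {1..7}"
  shows "crd (\<Sum>k=1..7. h k *\<^sub>R eb k) j = h j"
proof -
  have "crd (\<Sum>k=1..7. h k *\<^sub>R eb k) j = (\<Sum>k=1..7. h k * crd (eb k) j)"
    by (simp only: sum_1_7 crd_simps)
  also have "\<dots> = (\<Sum>k=1..7. if k = j then h k else 0)"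
    by (rule sum.cong) (use assms in \<open>auto simp: crd_eb\<close>)
  finally show ?thesis using assms by simp
qed

lemma crd_lie_of_d:
  assumes "k \<in> {1..7}"
  shows "crd (lie_of_d D x y) k = - (\<Sum>i=1..7. \<Sum>j=1..7.
        if i < j then D k i j * (crd x i * crd y j - crd x j * crd y i) else 0)"
  unfolding lie_of_d_def by (rule crd_sum_eb[OF assms])

lemma crd_model0: "k \<in> {1..7} \<Longrightarrow> crd (model0 x y) k = 0"
  by (simp add: model0_def crd_lie_of_d del: sum.neutral_const One_nat_def cong: if_cong)

lemma crd_model1:
  "crd (model1 x y) 1 = 0" "crd (model1 x y) 2 = 0" "crd (model1 x y) 3 = 0" "crd (model1 x y) 4 = 0"
  "crd (model1 x y) 5 = crd x 2 * crd y 1 - crd x 1 * crd y 2"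
  "crd (model1 x y) 6 = crd x 3 * crd y 1 - crd x 1 * crd y 3"
  "crd (model1 x y) 7 = 0"
  by (simp_all add: model1_def crd_lie_of_d sum_1_7 del: One_nat_def)

lemma crd_model2:
  "crd (model2 x y) 1 = 0" "crd (model2 x y) 2 = 0" "crd (model2 x y) 3 = 0"
  "crd (model2 x y) 4 = crd x 2 * crd y 1 - crd x 1 * crd y 2"
  "crd (model2 x y) 5 = crd x 3 * crd y 1 - crd x 1 * crd y 3"
  "crd (model2 x y) 6 = crd x 3 * crd y 2 - crd x 2 * crd y 3"
  "crd (model2 x y) 7 = 0"
  by (simp_all add: model2_def crd_lie_of_d sum_1_7 del: One_nat_def)

text \<open>Evaluating a linear relation at \<open>eb (p i)\<close> isolates its i-th coefficient.
  The coframes chosen on the three models are all of this shape.\<close>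

lemma dual_basis7_scaled_perm:
  assumes s: "\<And>i. i \<in> {1..7} \<Longrightarrow> s i \<noteq> (0::real)"
    and p: "inj_on p {1..7::nat}" "p ` {1..7} \<subseteq> {1..7}"
  shows "dual_basis7 (\<lambda>i x. s i * crd x (p i))"
  unfolding dual_basis7_def
proof (intro conjI ballI allI impI)
  fix i show "linear (\<lambda>x. s i * crd x (p i))"
    by (rule linearI) (simp_all add: algebra_simps)
next
  fix c i assume h: "\<forall>x. (\<Sum>i=1..7. c i * (s i * crd x (p i))) = 0" and i: "i \<in> {1..7::nat}"
  have "(\<Sum>j=1..7. c j * (s j * crd (eb (p i)) (p j))) = (\<Sum>j=1..7. if j = i then c j * s j else 0)"
  proof (rule sum.cong)
    fix j assume j: "j \<in> {1..7::nat}"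
    have "crd (eb (p i)) (p j) = of_bool (p i = p j)"
      using i j p(2) by (intro crd_eb) blast+
    then show "c j * (s j * crd (eb (p i)) (p j)) = (if j = i then c j * s j else 0)"
      using i j p by (auto simp: inj_on_eq_iff)
  qed simp
  then have "c i * s i = 0" using h i by simp
  then show "c i = 0" using s[OF i] by simp
qed

lemma has_calibrated_G2_pullback:
  assumes "lie_iso br br'" "has_calibrated_G2 br'"
  shows "has_calibrated_G2 br"
proof -
  obtain f where f: "linear f" "bij f" "\<And>x y. f (br x y) = br' (f x) (f y)"
    using assms(1) unfolding lie_iso_def by blast
  obtain \<phi> h where h: "dual_basis7 h" "\<And>x y z. \<phi> x y z = g2_form h x y z"
    and d: "\<And>a b c e. ce_d3 br' \<phi> a b c e = 0"
    using assms(2) unfolding has_calibrated_G2_def G2_structure_def by metis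
  have "dual_basis7 (\<lambda>i x. h i (f x))"
    unfolding dual_basis7_def
  proof (intro conjI ballI allI impI)
    fix i :: nat assume "i \<in> {1..7}"
    then have "linear (h i)" using h(1) by (simp add: dual_basis7_def)
    then show "linear (\<lambda>x. h i (f x))" using linear_compose[OF f(1)] by (simp add: o_def)
  next
    fix c :: "nat \<Rightarrow> real" and i :: nat assume c: "\<forall>x. (\<Sum>i=1..7. c i * h i (f x)) = 0" and i: "i \<in> {1..7}"
    have "\<forall>y. (\<Sum>i=1..7. c i * h i y) = 0"
      using c f(2) by (metis bij_pointE)
    then show "c i = 0" using h(1) i unfolding dual_basis7_def by blast
  qed
  moreover have "\<forall>x y z. \<phi> (f x) (f y) (f z) = g2_form (\<lambda>i x. h i (f x)) x y z"
    unfolding h(2) by (simp add: g2_form_def wedge3_def)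
  moreover have "\<forall>a b c e. ce_d3 br (\<lambda>x y z. \<phi> (f x) (f y) (f z)) a b c e = 0"
  proof (intro allI)
    fix a b c e
    show "ce_d3 br (\<lambda>x y z. \<phi> (f x) (f y) (f z)) a b c e = 0"
      using d[of "f a" "f b" "f c" "f e"] by (simp add: ce_d3_def f(3))
  qed
  ultimately show ?thesis
    unfolding has_calibrated_G2_def G2_structure_def
    by (intro exI[of _ "\<lambda>x y z. \<phi> (f x) (f y) (f z)"] conjI exI[of _ "\<lambda>i x. h i (f x)"])
qed

lemma has_calibrated_G2I:
  assumes "dual_basis7 f" "\<And>a b c e. ce_d3 br (g2_form f) a b c e = 0"
  shows "has_calibrated_G2 br"
  using assms unfolding has_calibrated_G2_def G2_structure_def by blast

lemma has_calibrated_G2_model0: "has_calibrated_G2 model0"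
proof (rule has_calibrated_G2I)
  show "dual_basis7 (\<lambda>i x. 1 * crd x (id i))"
    by (rule dual_basis7_scaled_perm) auto
  show "ce_d3 model0 (g2_form (\<lambda>i x. 1 * crd x (id i))) a b c e = 0" for a b c e
    by (simp add: ce_d3_def g2_form_def wedge3_def crd_model0 del: One_nat_def)
qed

text \<open>In both models \<open>\<phi> = \<omega> \<and> e\<^sup>7 + \<rho>\<close> with every monomial of \<open>\<rho>\<close> closed, so the coefficients only have
  to make \<open>\<omega>\<close> closed: \<open>\<omega> = e\<^sup>1\<^sup>4 + e\<^sup>2\<^sup>6 + e\<^sup>3\<^sup>5\<close> for the first and \<open>\<omega> = e\<^sup>1\<^sup>6 + 2e\<^sup>2\<^sup>5 + e\<^sup>3\<^sup>4\<close> for the second.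
  The list entry at position 0 is a dummy.\<close>
lemma has_calibrated_G2_model1: "has_calibrated_G2 model1"
proof (rule has_calibrated_G2I)
  let ?p = "\<lambda>i. [0,1,4,2,6,3,5,7] ! (i::nat)"
  show "dual_basis7 (\<lambda>i x. 1 * crd x (?p i))"
    by (rule dual_basis7_scaled_perm) (simp_all add: atLeastAtMost_1_7 inj_on_def del: One_nat_def)
  show "ce_d3 model1 (g2_form (\<lambda>i x. 1 * crd x (?p i))) a b c e = 0" for a b c e
    by (simp add: ce_d3_def g2_form_def wedge3_def crd_model1 del: One_nat_def) algebra
qed

lemma has_calibrated_G2_model2: "has_calibrated_G2 model2"
proof (rule has_calibrated_G2I)
  let ?p = "\<lambda>i. [0,1,6,2,5,3,4,7] ! (i::nat)"
  \<comment> \<open>The differentials of e16, e25, e34 are -e123, +e123, -e123, so the middle term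
    needs the coefficient 2.\<close>
  let ?s = "\<lambda>i. if i = (4::nat) then 2 else (1::real)"
  show "dual_basis7 (\<lambda>i x. ?s i * crd x (?p i))"
    by (rule dual_basis7_scaled_perm) (simp_all add: atLeastAtMost_1_7 inj_on_def del: One_nat_def)
  show "ce_d3 model2 (g2_form (\<lambda>i x. ?s i * crd x (?p i))) a b c e = 0" for a b c e
    by (simp add: ce_d3_def g2_form_def wedge3_def crd_model2 del: One_nat_def) algebra
qed

section \<open>Linear algebra and nondegeneracy of G2-forms\<close>

lemma dim_kernel_functional:
  fixes f :: "'a::euclidean_space \<Rightarrow> real"
  assumes "linear f" "subspace U"
  shows "dim U \<le> dim {u \<in> U. f u = 0} + 1"
proof (cases "\<exists>u\<in>U. f u \<noteq> 0")
  case True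
  then obtain u where u: "u \<in> U" "f u \<noteq> 0" by blast
  have "U \<subseteq> span (insert u {u \<in> U. f u = 0})"
  proof
    fix v assume v: "v \<in> U"
    have "v - (f v / f u) *\<^sub>R u \<in> {u \<in> U. f u = 0}"
      using u v assms by (simp add: linear_diff linear_scale subspace_diff subspace_scale)
    then show "v \<in> span (insert u {u \<in> U. f u = 0})"
      by (meson span_base span_breakdown_eq)
  qed
  then have "dim U \<le> dim (insert u {u \<in> U. f u = 0})"
    by (metis dim_span dim_subset)
  also have "\<dots> \<le> dim {u \<in> U. f u = 0} + 1"
    by (simp add: dim_insert)
  finally show ?thesis .
next
  case False
  then have "{u \<in> U. f u = 0} = U" by auto
  then show ?thesis by simp
qed

lemma in_span_if_orthogonal_annihilator:
  fixes w :: "'a::euclidean_space"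
  assumes "\<And>u. (\<And>v. v \<in> S \<Longrightarrow> v \<bullet> u = 0) \<Longrightarrow> w \<bullet> u = 0"
  shows "w \<in> span S"
proof -
  obtain y z where yz: "y \<in> span S" "\<And>v. v \<in> span S \<Longrightarrow> orthogonal z v" "w = y + z"
    using orthogonal_subspace_decomp_exists[of S w] by metis
  have "w \<bullet> z = 0"
    using yz(2) by (intro assms) (metis inner_commute orthogonal_def span_base)
  moreover have "y \<bullet> z = 0"
    using yz(1,2) by (metis inner_commute orthogonal_def)
  ultimately have "z = 0" using yz(3) by (simp add: inner_left_distrib)
  then show ?thesis using yz by simp
qed

lemma coeff_unique2:
  fixes Y Z :: "'a::real_vector"
  assumes "Z \<noteq> 0" "Y \<notin> span {Z}" "a *\<^sub>R Y + b *\<^sub>R Z = a' *\<^sub>R Y + b' *\<^sub>R Z"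
  shows "a = a' \<and> b = b'"
proof -
  have e: "(a - a') *\<^sub>R Y = (b' - b) *\<^sub>R Z" using assms(3) by (simp add: algebra_simps)
  have "a = a'"
  proof (rule ccontr)
    assume "a \<noteq> a'"
    then have "Y = ((b' - b) / (a - a')) *\<^sub>R Z"
      using arg_cong[OF e, of "\<lambda>v. (1 / (a - a')) *\<^sub>R v"] by simp
    then show False using assms(2) by (auto simp: span_singleton)
  qed
  then show ?thesis using e assms(1) by simp
qed

text \<open>Seven spanning vectors in dimension 7 form a basis, and skew-symmetry recovers all
  brackets from those with i < j. The map \<open>g\<close> runs from the model to the given algebra,
  so the isomorphism is its inverse. The minus sign is that of de^k(x, y) = -e^k([x, y]).\<close>

lemma lie_iso_lie_of_d:
  fixes br :: "'a::euclidean_space \<Rightarrow> 'a \<Rightarrow> 'a" and e :: "nat \<Rightarrow> 'a"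
  assumes dim: "DIM('a) = 7" and lie: "lie_algebra br"
    and gen: "span (e ` {1..7}) = UNIV"
    and br: "\<And>i j. i \<in> {1..7} \<Longrightarrow> j \<in> {1..7} \<Longrightarrow> i < j \<Longrightarrow>
               br (e i) (e j) = - (\<Sum>k=1..7. D k i j *\<^sub>R e k)"
  shows "lie_iso br (lie_of_d D)"
proof -
  define g where "g x = (\<Sum>i=1..7. crd x i *\<^sub>R e i)" for x
  have lin_g: "linear g"
    by (rule linearI) (simp_all add: g_def algebra_simps sum.distrib scaleR_sum_right)
  have "g (eb j) = e j" if "j \<in> {1..7}" for j
  proof -
    have "g (eb j) = (\<Sum>i=1..7. if i = j then e i else 0)"
      unfolding g_def by (rule sum.cong) (use that in \<open>auto simp: crd_eb\<close>)
    then show ?thesis using that by simp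
  qed
  then have "e ` {1..7} \<subseteq> range g" by (metis image_subsetI rangeI)
  then have "surj g"
    using gen lin_g by (metis linear_subspace_image span_minimal subspace_UNIV top.extremum_unique)
  moreover have "inj g"
    using linear_surjective_imp_injective[OF lin_g \<open>surj g\<close>] dim by simp
  ultimately have bij: "bij g" by (simp add: bij_def)
  have l1: "linear (br x)" and l2: "linear (\<lambda>x. br x y)" and alt: "br x x = 0" for x y
    using lie by (auto simp: lie_algebra_def)
  have skew: "br y x = - br x y" for x y
  proof -
    have "br (x + y) (x + y) = br x x + br x y + (br y x + br y y)"
      by (simp only: linear_add[OF l1] linear_add[OF l2] ac_simps)
    then show ?thesis by (simp add: alt eq_neg_iff_add_eq_0 add.commute)
  qed
  have hom: "br (g x) (g y) = g (lie_of_d D x y)" for x y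
  proof -
    have "br (g x) (g y) = (\<Sum>i=1..7. \<Sum>j=1..7. (crd x i * crd y j) *\<^sub>R br (e i) (e j))"
    proof -
      have "br (g x) (g y) = (\<Sum>i=1..7. br (crd x i *\<^sub>R e i) (g y))"
        unfolding g_def[of x] by (rule linear_sum[OF l2])
      also have "\<dots> = (\<Sum>i=1..7. crd x i *\<^sub>R br (e i) (g y))"
        using linear_scale[OF l2] by (intro sum.cong refl) auto
      also have "\<dots> = (\<Sum>i=1..7. crd x i *\<^sub>R (\<Sum>j=1..7. crd y j *\<^sub>R br (e i) (e j)))"
        unfolding g_def by (simp only: linear_sum[OF l1] linear_scale[OF l1])
      finally show ?thesis by (simp only: scaleR_sum_right scaleR_scaleR)
    qed
    also have "\<dots> = (\<Sum>i=1..7. \<Sum>j=1..7. if i < j then (crd x i * crd y j) *\<^sub>R br (e i) (e j) else 0)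
        + (\<Sum>i=1..7. \<Sum>j=1..7. if j < i then (crd x i * crd y j) *\<^sub>R br (e i) (e j) else 0)"
      unfolding sum.distrib[symmetric]
      by (intro sum.cong refl) (auto simp: alt not_less_iff_gr_or_eq)
    also have "(\<Sum>i=1..7. \<Sum>j=1..7. if j < i then (crd x i * crd y j) *\<^sub>R br (e i) (e j) else 0)
        = (\<Sum>i=1..7. \<Sum>j=1..7. if i < j then - (crd x j * crd y i) *\<^sub>R br (e i) (e j) else 0)"
    proof (subst sum.swap, intro sum.cong refl)
      fix i j
      show "(if i < j then (crd x j * crd y i) *\<^sub>R br (e j) (e i) else 0)
          = (if i < j then - (crd x j * crd y i) *\<^sub>R br (e i) (e j) else 0)"
        by (subst skew[of "e j" "e i"]) simp
    qed
    also have "(\<Sum>i=1..7. \<Sum>j=1..7. if i < j then (crd x i * crd y j) *\<^sub>R br (e i) (e j) else 0) + \<dots>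
        = (\<Sum>i=1..7. \<Sum>j=1..7. if i < j then (crd x i * crd y j - crd x j * crd y i) *\<^sub>R br (e i) (e j) else 0)"
      unfolding sum.distrib[symmetric]
      by (intro sum.cong refl) (auto simp: algebra_simps)
    also have "\<dots> = (\<Sum>i=1..7. \<Sum>j=1..7. \<Sum>k=1..7. (if i < j then - (D k i j * (crd x i * crd y j - crd x j * crd y i)) else 0) *\<^sub>R e k)"
    proof (intro sum.cong refl)
      fix i j :: nat assume ij: "i \<in> {1..7}" "j \<in> {1..7}"
      show "(if i < j then (crd x i * crd y j - crd x j * crd y i) *\<^sub>R br (e i) (e j) else 0)
        = (\<Sum>k=1..7. (if i < j then - (D k i j * (crd x i * crd y j - crd x j * crd y i)) else 0) *\<^sub>R e k)"
        by (cases "i < j") (simp_all add: br[OF ij] scaleR_sum_right sum_negf mult.commute)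
    qed
    also have "\<dots> = (\<Sum>k=1..7. \<Sum>i=1..7. \<Sum>j=1..7. (if i < j then - (D k i j * (crd x i * crd y j - crd x j * crd y i)) else 0) *\<^sub>R e k)"
      by (rule trans[OF sum.cong[OF refl sum.swap] sum.swap])
    also have "\<dots> = (\<Sum>k=1..7. crd (lie_of_d D x y) k *\<^sub>R e k)"
    proof (intro sum.cong refl)
      fix k :: nat assume k: "k \<in> {1..7}"
      have "crd (lie_of_d D x y) k = (\<Sum>i=1..7. \<Sum>j=1..7.
          if i < j then - (D k i j * (crd x i * crd y j - crd x j * crd y i)) else 0)"
        unfolding crd_lie_of_d[OF k] sum_negf[symmetric] by (intro sum.cong refl) auto
      then show "(\<Sum>i=1..7. \<Sum>j=1..7. (if i < j then - (D k i j * (crd x i * crd y j - crd x j * crd y i)) else 0) *\<^sub>R e k)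
          = crd (lie_of_d D x y) k *\<^sub>R e k"
        by (simp only: scaleR_sum_left)
    qed
    finally show ?thesis by (simp add: g_def)
  qed
  have gi: "g (inv g x) = x" for x using bij by (simp add: bij_is_surj surj_f_inv_f)
  have ig: "inv g (g x) = x" for x using bij by (simp add: bij_is_inj)
  have "linear (inv g)"
  proof (rule linearI)
    show "inv g (x + y) = inv g x + inv g y" for x y
      using ig[of "inv g x + inv g y"] by (simp only: linear_add[OF lin_g] gi)
    show "inv g (c *\<^sub>R x) = c *\<^sub>R inv g x" for c x
      using ig[of "c *\<^sub>R inv g x"] by (simp only: linear_scale[OF lin_g] gi)
  qed
  moreover have "inv g (br x y) = lie_of_d D (inv g x) (inv g y)" for x y
    using ig[of "lie_of_d D (inv g x) (inv g y)"] by (simp only: hom[symmetric] gi)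
  ultimately show ?thesis
    using bij_imp_bij_inv[OF bij] unfolding lie_iso_def by blast
qed

text \<open>A vector orthogonal to the range is a linear relation among the functionals, hence 0. So
  independence gives surjectivity, and equality of dimensions gives injectivity.\<close>

lemma dual_basis7_bij:
  fixes f :: "nat \<Rightarrow> 'a::euclidean_space \<Rightarrow> real"
  assumes dim: "DIM('a) = 7" and f: "dual_basis7 f"
  shows "bij (\<lambda>x. \<Sum>i=1..7. f i x *\<^sub>R eb i)" (is "bij ?F")
proof -
  have lin: "linear (f i)" if "i \<in> {1..7}" for i
    using f that by (auto simp: dual_basis7_def)
  have linF: "linear ?F"
    by (rule linear_compose_sum) (use lin in \<open>auto intro!: linearI simp: linear_add linear_scale algebra_simps\<close>)
  have "c \<in> span (range ?F)" for c
  proof (rule in_span_if_orthogonal_annihilator)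
    fix u assume u: "\<And>v. v \<in> range ?F \<Longrightarrow> v \<bullet> u = 0"
    have eu: "eb i \<bullet> u = crd u i" for i
      by (simp add: eb_def crd_def inner_axis' )
    have "(\<Sum>i=1..7. crd u i * f i x) = 0" for x
    proof -
      have "?F x \<bullet> u = 0" using u by blast
      then show ?thesis by (simp add: inner_sum_left eu mult.commute)
    qed
    then have "\<forall>i\<in>{1..7}. crd u i = 0"
      using f unfolding dual_basis7_def by blast
    then have "u = 0" by (intro crd_eqI) auto
    then show "c \<bullet> u = 0" by simp
  qed
  moreover have "span (range ?F) = range ?F"
    using linF by (simp add: linear_subspace_image span_eq_iff)
  ultimately have "surj ?F" by blast
  moreover from this have "inj ?F"
    using linear_surjective_imp_injective[OF linF] dim by simp
  ultimately show ?thesis by (simp add: bij_def)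
qed

text \<open>The seven assumptions say that the octonionic cross product of x and y vanishes; the sum of
  their squares is the Gram determinant of x and y.\<close>
lemma cross_product_zero_imp_proportional:
  fixes x y :: "nat \<Rightarrow> real"
  assumes ij: "i \<in> {1..7}" "j \<in> {1..7}"
    and c: "(x 2 * y 7 - x 7 * y 2) + (x 3 * y 5 - x 5 * y 3) - (x 4 * y 6 - x 6 * y 4) = 0"
      "(x 1 * y 7 - x 7 * y 1) + (x 3 * y 6 - x 6 * y 3) + (x 4 * y 5 - x 5 * y 4) = 0"
      "(x 4 * y 7 - x 7 * y 4) - (x 1 * y 5 - x 5 * y 1) + (x 2 * y 6 - x 6 * y 2) = 0"
      "(x 3 * y 7 - x 7 * y 3) - (x 1 * y 6 - x 6 * y 1) - (x 2 * y 5 - x 5 * y 2) = 0"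
      "(x 6 * y 7 - x 7 * y 6) + (x 1 * y 3 - x 3 * y 1) - (x 2 * y 4 - x 4 * y 2) = 0"
      "(x 5 * y 7 - x 7 * y 5) + (x 2 * y 3 - x 3 * y 2) + (x 1 * y 4 - x 4 * y 1) = 0"
      "(x 1 * y 2 - x 2 * y 1) + (x 3 * y 4 - x 4 * y 3) + (x 5 * y 6 - x 6 * y 5) = 0"
  shows "x i * y j = x j * y i"
proof -
  have "(\<Sum>i=1..7. \<Sum>j=1..7. (x i * y j - x j * y i)\<^sup>2) = 2 * (
      ((x 2 * y 7 - x 7 * y 2) + (x 3 * y 5 - x 5 * y 3) - (x 4 * y 6 - x 6 * y 4))\<^sup>2 +
      ((x 1 * y 7 - x 7 * y 1) + (x 3 * y 6 - x 6 * y 3) + (x 4 * y 5 - x 5 * y 4))\<^sup>2 +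
      ((x 4 * y 7 - x 7 * y 4) - (x 1 * y 5 - x 5 * y 1) + (x 2 * y 6 - x 6 * y 2))\<^sup>2 +
      ((x 3 * y 7 - x 7 * y 3) - (x 1 * y 6 - x 6 * y 1) - (x 2 * y 5 - x 5 * y 2))\<^sup>2 +
      ((x 6 * y 7 - x 7 * y 6) + (x 1 * y 3 - x 3 * y 1) - (x 2 * y 4 - x 4 * y 2))\<^sup>2 +
      ((x 5 * y 7 - x 7 * y 5) + (x 2 * y 3 - x 3 * y 2) + (x 1 * y 4 - x 4 * y 1))\<^sup>2 +
      ((x 1 * y 2 - x 2 * y 1) + (x 3 * y 4 - x 4 * y 3) + (x 5 * y 6 - x 6 * y 5))\<^sup>2)"
    unfolding sum_1_7 by (simp add: power2_eq_square algebra_simps del: One_nat_def)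
  also have "\<dots> = 0" unfolding c by simp
  finally have "(\<Sum>i=1..7. \<Sum>j=1..7. (x i * y j - x j * y i)\<^sup>2) = 0" .
  then have "\<forall>i\<in>{1..7}. (\<Sum>j=1..7. (x i * y j - x j * y i)\<^sup>2) = 0"
    by (subst (asm) sum_nonneg_eq_0_iff) (auto intro: sum_nonneg)
  then have "(\<Sum>j=1..7. (x i * y j - x j * y i)\<^sup>2) = 0" using ij(1) by blast
  then have "(x i * y j - x j * y i)\<^sup>2 = 0"
    using ij(2) by (subst (asm) sum_nonneg_eq_0_iff) auto
  then show ?thesis by simp
qed

lemma g2_form_nondegenerate:
  fixes f :: "nat \<Rightarrow> 'a::euclidean_space \<Rightarrow> real"
  assumes dim: "DIM('a) = 7" and f: "dual_basis7 f"
    and zero: "\<And>z. g2_form f x y z = 0" and x: "x \<noteq> 0"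
  shows "\<exists>t. y = t *\<^sub>R x"
proof -
  let ?F = "\<lambda>x. \<Sum>i=1..7. f i x *\<^sub>R eb i"
  have bij: "bij ?F" by (rule dual_basis7_bij[OF dim f])
  have crdF: "crd (?F z) i = f i z" if "i \<in> {1..7}" for i z
    using that by (rule crd_sum_eb)
  have lin: "linear (f i)" if "i \<in> {1..7}" for i
    using f that by (auto simp: dual_basis7_def)
  have eqI: "u = v" if "\<And>i. i \<in> {1..7} \<Longrightarrow> f i u = f i v" for u v
  proof -
    have "?F u = ?F v" by (intro sum.cong refl) (simp add: that)
    then show ?thesis by (rule injD[OF bij_is_inj[OF bij]])
  qed
  \<comment> \<open>This is the basis dual to \<open>f\<close>. Inserting \<open>e k\<close> as
    third argument turns the hypothesis into the k-th component of the cross product of x and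
    y.\<close>
  define e where "e k = inv ?F (eb k)" for k
  have fe: "f i (e k) = of_bool (k = i)" if "i \<in> {1..7}" "k \<in> {1..7}" for i k
  proof -
    have "?F (e k) = eb k" unfolding e_def by (rule surj_f_inv_f[OF bij_is_surj[OF bij]])
    then show ?thesis using crdF[OF that(1), of "e k"] crd_eb[OF that(2,1)] by simp
  qed
  have prp: "f i x * f j y = f j x * f i y" if "i \<in> {1..7}" "j \<in> {1..7}" for i j
  proof (rule cross_product_zero_imp_proportional[OF that])
    show "(f 2 x * f 7 y - f 7 x * f 2 y) + (f 3 x * f 5 y - f 5 x * f 3 y) - (f 4 x * f 6 y - f 6 x * f 4 y) = 0"
      using zero[of "e 1"] by (simp add: g2_form_def wedge3_def fe del: One_nat_def)
    show "(f 1 x * f 7 y - f 7 x * f 1 y) + (f 3 x * f 6 y - f 6 x * f 3 y) + (f 4 x * f 5 y - f 5 x * f 4 y) = 0"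
      using zero[of "e 2"] by (simp add: g2_form_def wedge3_def fe del: One_nat_def)
    show "(f 4 x * f 7 y - f 7 x * f 4 y) - (f 1 x * f 5 y - f 5 x * f 1 y) + (f 2 x * f 6 y - f 6 x * f 2 y) = 0"
      using zero[of "e 3"] by (simp add: g2_form_def wedge3_def fe del: One_nat_def)
    show "(f 3 x * f 7 y - f 7 x * f 3 y) - (f 1 x * f 6 y - f 6 x * f 1 y) - (f 2 x * f 5 y - f 5 x * f 2 y) = 0"
      using zero[of "e 4"] by (simp add: g2_form_def wedge3_def fe del: One_nat_def)
    show "(f 6 x * f 7 y - f 7 x * f 6 y) + (f 1 x * f 3 y - f 3 x * f 1 y) - (f 2 x * f 4 y - f 4 x * f 2 y) = 0"
      using zero[of "e 5"] by (simp add: g2_form_def wedge3_def fe del: One_nat_def)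
    show "(f 5 x * f 7 y - f 7 x * f 5 y) + (f 2 x * f 3 y - f 3 x * f 2 y) + (f 1 x * f 4 y - f 4 x * f 1 y) = 0"
      using zero[of "e 6"] by (simp add: g2_form_def wedge3_def fe del: One_nat_def)
    show "(f 1 x * f 2 y - f 2 x * f 1 y) + (f 3 x * f 4 y - f 4 x * f 3 y) + (f 5 x * f 6 y - f 6 x * f 5 y) = 0"
      using zero[of "e 7"] by (simp add: g2_form_def wedge3_def fe del: One_nat_def)
  qed
  have "\<exists>i\<in>{1..7}. f i x \<noteq> 0"
    using eqI[of x 0] x lin by (metis linear_0)
  then obtain i where i: "i \<in> {1..7}" "f i x \<noteq> 0" by blast
  have "y = (f i y / f i x) *\<^sub>R x"
  proof (rule eqI)
    fix j :: nat assume j: "j \<in> {1..7}"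
    show "f j y = f j ((f i y / f i x) *\<^sub>R x)"
      using prp[OF i(1) j] i(2) linear_scale[OF lin[OF j]] by (simp add: field_simps)
  qed
  then show ?thesis by blast
qed

section \<open>Nilpotent Lie algebras with a closed G2-form\<close>

locale calibrated_lie =
  fixes br :: "'a::euclidean_space \<Rightarrow> 'a \<Rightarrow> 'a" and phi :: "'a \<Rightarrow> 'a \<Rightarrow> 'a \<Rightarrow> real"
  assumes dim7: "DIM('a) = 7" and lie: "lie_algebra br" and nilpotent: "nilpotent_lie br"
    and g2: "G2_structure phi" and closed: "ce_d3 br phi a b c e = 0"
begin

section \<open>Multilinear calculus of the bracket and the form\<close>

lemma linear_br: "linear (br x)" "linear (\<lambda>x. br x y)"
  using lie by (auto simp: lie_algebra_def)

lemma br_simps [simp]: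
  "br x x = 0" "br (x + y) z = br x z + br y z" "br x (y + z) = br x y + br x z"
  "br (x - y) z = br x z - br y z" "br x (y - z) = br x y - br x z"
  "br (c *\<^sub>R x) y = c *\<^sub>R br x y" "br x (c *\<^sub>R y) = c *\<^sub>R br x y"
  "br 0 x = 0" "br x 0 = 0" "br (- x) y = - br x y" "br x (- y) = - br x y"
  using lie linear_add[OF linear_br(1)] linear_add[OF linear_br(2)] linear_diff[OF linear_br(1)]
    linear_diff[OF linear_br(2)] linear_scale[OF linear_br(1)] linear_scale[OF linear_br(2)]
    linear_0[OF linear_br(1)] linear_0[OF linear_br(2)] linear_neg[OF linear_br(1)] linear_neg[OF linear_br(2)]
  by (auto simp: lie_algebra_def)

lemma br_skew: "br y x = - br x y"
proof -
  have "br (x + y) (x + y) = br x y + br y x"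
    by (simp only: br_simps(2,3)) simp
  then have "br x y + br y x = 0" by (simp only: br_simps(1))
  then show ?thesis by (simp add: eq_neg_iff_add_eq_0 add.commute)
qed

lemma jacobi: "br x (br y z) + br y (br z x) + br z (br x y) = 0"
  using lie by (simp add: lie_algebra_def)

lemma jacobi_derivation: "br x (br y z) = br (br x y) z + br y (br x z)"
proof -
  have "br z (br x y) = - br (br x y) z" "br y (br z x) = - br y (br x z)"
    using br_skew[of z x] br_skew[of z "br x y"] by simp_all
  then show ?thesis using jacobi[of x y z] by (simp add: add_eq_0_iff2 diff_eq_eq)
qed

lemma phi_form: obtains f where "dual_basis7 f" "\<And>x y z. phi x y z = g2_form f x y z"
  using g2 unfolding G2_structure_def by blast

lemma phi_skew: "phi y x z = - phi x y z" "phi x z y = - phi x y z"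
proof -
  obtain f where "dual_basis7 f" and f: "\<And>x y z. phi x y z = g2_form f x y z"
    using phi_form by blast
  show "phi y x z = - phi x y z" "phi x z y = - phi x y z"
    unfolding f g2_form_def wedge3_def by (simp_all add: algebra_simps)
qed

lemma linear_phi: "linear (phi x y)"
proof -
  obtain f where d: "dual_basis7 f" and f: "\<And>x y z. phi x y z = g2_form f x y z"
    using phi_form by blast
  have "linear (f i)" if "i \<in> {1..7}" for i using d that by (auto simp: dual_basis7_def)
  then have l: "f i (u + v) = f i u + f i v" "f i (c *\<^sub>R u) = c * f i u" if "i \<in> {1..7}" for i u v c
    using that by (simp_all add: linear_add linear_scale)
  show ?thesis
    unfolding f g2_form_def wedge3_def
    by (rule linearI) (simp_all add: l algebra_simps del: One_nat_def)
qed

lemma phi_simps3: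
  "phi x y (u + v) = phi x y u + phi x y v" "phi x y (u - v) = phi x y u - phi x y v"
  "phi x y (c *\<^sub>R u) = c * phi x y u" "phi x y 0 = 0" "phi x y (- u) = - phi x y u"
  using linear_add[OF linear_phi] linear_diff[OF linear_phi] linear_scale[OF linear_phi]
    linear_0[OF linear_phi] linear_neg[OF linear_phi] by simp_all

lemma phi_alt [simp]: "phi x x y = 0" "phi y x x = 0" "phi x y x = 0"
  using phi_skew(1)[of x x y] phi_skew(2)[of y x x] phi_skew(2)[of x y x] phi_skew(1)[of x x y] by auto

lemma phi_simps [simp]:
  "phi x y (u + v) = phi x y u + phi x y v" "phi x y (u - v) = phi x y u - phi x y v"
  "phi x y (c *\<^sub>R u) = c * phi x y u" "phi x y 0 = 0" "phi x y (- u) = - phi x y u"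
  "phi x (u + v) y = phi x u y + phi x v y" "phi x (u - v) y = phi x u y - phi x v y"
  "phi x (c *\<^sub>R u) y = c * phi x u y" "phi x 0 y = 0" "phi x (- u) y = - phi x u y"
  "phi (u + v) x y = phi u x y + phi v x y" "phi (u - v) x y = phi u x y - phi v x y"
  "phi (c *\<^sub>R u) x y = c * phi u x y" "phi 0 x y = 0" "phi (- u) x y = - phi u x y"
proof -
  have p2: "phi x u y = - phi x y u" and p1: "phi u x y = phi x y u" for x y u
    using phi_skew(2)[of x y u] phi_skew(1)[of x u y] phi_skew(2)[of x y u] by simp_all
  show "phi x (u + v) y = phi x u y + phi x v y" "phi x (u - v) y = phi x u y - phi x v y"
    "phi x (c *\<^sub>R u) y = c * phi x u y" "phi x 0 y = 0" "phi x (- u) y = - phi x u y"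
    by (simp_all only: p2[of x _ y] phi_simps3)
  show "phi (u + v) x y = phi u x y + phi v x y" "phi (u - v) x y = phi u x y - phi v x y"
    "phi (c *\<^sub>R u) x y = c * phi u x y" "phi 0 x y = 0" "phi (- u) x y = - phi u x y"
    by (simp_all only: p1[of _ x y] phi_simps3)
qed (simp_all add: phi_simps3)

lemma phi_rotate: "phi x y z = phi y z x"
  using phi_skew(2)[of y z x] phi_skew(1)[of y x z] by simp

lemma phi_nondegenerate:
  assumes "\<And>z. phi x y z = 0" "x \<noteq> 0"
  shows "y \<in> span {x}"
proof -
  obtain f where d: "dual_basis7 f" and f: "\<And>x y z. phi x y z = g2_form f x y z"
    using phi_form by blast
  obtain t where "y = t *\<^sub>R x"
    using g2_form_nondegenerate[OF dim7 d, of x y] assms unfolding f by auto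
  then show ?thesis by (auto simp: span_singleton)
qed

lemma closed_phi:
  "phi (br a b) c e - phi (br a c) b e + phi (br a e) b c
     + phi (br b c) a e - phi (br b e) a c + phi (br c e) a b = 0"
  using closed[of a b c e] by (simp add: ce_d3_def)

text \<open>Contracting the closed form with a central element gives a closed 2-form.\<close>
lemma phi_central_br:
  assumes "\<And>x. br C x = 0"
  shows "phi C A (br u v) = phi C (br A u) v - phi C (br A v) u"
proof -
  have "phi (br A u) C v = - phi C (br A u) v" "phi (br A v) C u = - phi C (br A v) u"
    "phi (br u v) C A = - phi C (br u v) A" "phi C (br u v) A = - phi C A (br u v)"
    using phi_skew by blast+
  then show ?thesis using closed_phi[of C A u v] assms by simp
qed

section \<open>The cross product and bounds on isotropic subspaces\<close>

text \<open>The vector representing \<phi>(x, y, \<cdot>) in the ambient inner product. Turning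
  functionals into vectors makes annihilators into orthogonal complements, whose dimensions are
  available.\<close>

definition cross :: "'a \<Rightarrow> 'a \<Rightarrow> 'a" where
  "cross x y = (\<Sum>b\<in>Basis. phi x y b *\<^sub>R b)"

lemma inner_cross: "cross x y \<bullet> z = phi x y z"
proof -
  have "phi x y z = phi x y (\<Sum>b\<in>Basis. (z \<bullet> b) *\<^sub>R b)"
    by (simp only: euclidean_representation)
  also have "\<dots> = (\<Sum>b\<in>Basis. (z \<bullet> b) * phi x y b)"
    by (simp only: linear_sum[OF linear_phi] phi_simps)
  also have "\<dots> = cross x y \<bullet> z"
    by (simp add: cross_def inner_sum_left inner_commute[of z] mult.commute)
  finally show ?thesis by simp
qed

lemma linear_cross: "linear (cross x)"
  by (rule linearI) (simp_all add: cross_def scaleR_sum_right scaleR_left_distrib sum.distrib)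

lemma cross_simps:
  "cross x (u + v) = cross x u + cross x v" "cross x (u - v) = cross x u - cross x v"
  "cross x (c *\<^sub>R u) = c *\<^sub>R cross x u"
  "cross (u + v) x = cross u x + cross v x" "cross (u - v) x = cross u x - cross v x"
  "cross (c *\<^sub>R u) x = c *\<^sub>R cross u x" "cross x x = 0"
  by (simp_all add: cross_def scaleR_sum_right scaleR_left_distrib scaleR_left_diff_distrib sum.distrib sum_subtractf)

lemma cross_skew: "cross y x = - cross x y"
  by (simp add: cross_def phi_skew(1)[of x y] sum_negf)

lemma cross_eq_0:
  assumes "cross x y = 0" "x \<noteq> 0"
  shows "y \<in> span {x}"
  using assms by (intro phi_nondegenerate) (metis inner_cross inner_zero_left)

lemma dim_orthogonal:
  fixes M :: "'a set"
  assumes "subspace M"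
  shows "dim {y. \<forall>x\<in>M. x \<bullet> y = 0} + dim M = 7"
  using dim_subspace_orthogonal_to_vectors[OF assms subspace_UNIV] dim7
  by (simp add: orthogonal_def)

text \<open>On the part of U orthogonal to Z, which loses at most one dimension,
  \<open>cross Z\<close> is injective because its kernel is the line of Z. Its image lies in the
  orthogonal complement of M, so dim U - 1 \<le> 7 - dim M.\<close>

lemma dim_isotropic_le:
  assumes "Z \<noteq> 0" "subspace U" "subspace M" "\<And>u m. u \<in> U \<Longrightarrow> m \<in> M \<Longrightarrow> phi Z u m = 0"
  shows "dim U + dim M \<le> 8"
proof -
  define U' where "U' = {u \<in> U. Z \<bullet> u = 0}"
  have lin: "linear (\<lambda>u. Z \<bullet> u)" by (simp add: bounded_linear.linear bounded_linear_inner_right)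
  have U': "subspace U'"
    using assms(2) unfolding U'_def subspace_def by (auto simp: inner_right_distrib)
  have "dim U \<le> dim U' + 1"
    unfolding U'_def by (rule dim_kernel_functional[OF lin assms(2)])
  moreover have "dim U' \<le> dim (cross Z ` U')"
  proof -
    have "inj_on (cross Z) U'"
    proof (rule inj_onI)
      fix u v assume uv: "u \<in> U'" "v \<in> U'" "cross Z u = cross Z v"
      then have "cross Z (u - v) = 0" by (simp add: cross_simps)
      then have "u - v \<in> span {Z}" using assms(1) by (intro cross_eq_0)
      then obtain t where t: "u - v = t *\<^sub>R Z" by (auto simp: span_singleton)
      moreover have "Z \<bullet> (u - v) = 0" using uv by (simp add: U'_def inner_diff_right)
      ultimately show "u = v" using assms(1) by simp
    qed
    then have "inj_on (cross Z) (span U')" using U' by (metis span_eq_iff)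
    then show ?thesis using dim_image_eq[OF linear_cross] by simp
  qed
  moreover have "dim (cross Z ` U') \<le> dim {y. \<forall>x\<in>M. x \<bullet> y = 0}"
    using assms(4) by (intro dim_subset) (auto simp: U'_def inner_cross[symmetric] inner_commute)
  ultimately show ?thesis using dim_orthogonal[OF assms(3)] by linarith
qed

text \<open>The three cross products are linearly independent and orthogonal to M. Every bivector on
  a 3-space is decomposable, so a linear relation among them would be a vanishing cross product of
  two independent vectors.\<close>

lemma dim_triple_le:
  assumes "x \<noteq> 0" "y \<notin> span {x}" "z \<notin> span {x, y}" "subspace M"
    and "\<And>m. m \<in> M \<Longrightarrow> phi x y m = 0" "\<And>m. m \<in> M \<Longrightarrow> phi x z m = 0" "\<And>m. m \<in> M \<Longrightarrow> phi y z m = 0"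
  shows "dim M \<le> 4"
proof -
  let ?S = "{cross y z, cross x z, cross x y}"
  have 1: "cross x y \<noteq> 0" using cross_eq_0 assms(1,2) by blast
  have 2: "cross x z \<notin> span {cross x y}"
  proof
    assume "cross x z \<in> span {cross x y}"
    then obtain k where "cross x z = k *\<^sub>R cross x y" by (auto simp: span_singleton)
    then have "cross x (z - k *\<^sub>R y) = 0" by (simp add: cross_simps)
    then have "z - k *\<^sub>R y \<in> span {x}" using assms(1) by (intro cross_eq_0)
    then have "z \<in> span {y, x}" using span_breakdown_eq by blast
    then show False using assms(3) by (simp add: insert_commute)
  qed
  have 3: "cross y z \<notin> span {cross x z, cross x y}"
  proof
    assume "cross y z \<in> span {cross x z, cross x y}"
    then obtain a b where ab: "cross y z = a *\<^sub>R cross x z + b *\<^sub>R cross x y"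
      by (auto simp: span_insert span_singleton algebra_simps)
    \<comment> \<open>The factorisation of y \<and> z - a x \<and> z - b x \<and> y.\<close>
    have "cross (y - a *\<^sub>R x) (z + b *\<^sub>R x) = 0"
      using ab cross_skew[of y x] by (simp add: cross_simps)
    moreover have "y - a *\<^sub>R x \<noteq> 0" using assms(2) by (auto simp: span_singleton)
    ultimately have "z + b *\<^sub>R x \<in> span {y - a *\<^sub>R x}" by (rule cross_eq_0)
    then obtain t where "z + b *\<^sub>R x = t *\<^sub>R (y - a *\<^sub>R x)" by (auto simp: span_singleton)
    then have "z = t *\<^sub>R y - (b + t * a) *\<^sub>R x" by (simp add: algebra_simps add_eq_0_iff eq_diff_eq)
    moreover have "t *\<^sub>R y - (b + t * a) *\<^sub>R x \<in> span {x, y}"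
      by (intro span_diff span_scale span_base) auto
    ultimately show False using assms(3) by simp
  qed
  have "dim ?S = 3" using 1 2 3 by (simp add: dim_insert span_singleton)
  moreover have "dim ?S \<le> dim {y. \<forall>x\<in>M. x \<bullet> y = 0}"
    using assms(5-7) by (intro dim_subset) (auto simp: inner_cross[symmetric] inner_commute)
  ultimately show ?thesis using dim_orthogonal[OF assms(4)] by linarith
qed

text \<open>Since \<open>cross Z\<close> has kernel \<langle>Z\<rangle>, independence of t from Z
  and V makes \<phi>(Z, t, \<cdot>) independent of the functionals \<phi>(Z, v, \<cdot>). This is
  the source of all vectors dual to contractions of \<phi> below.\<close>

lemma dual_vector:
  assumes "Z \<noteq> 0" "t \<notin> span (insert Z V)"
  shows "\<exists>a. phi Z t a = 1 \<and> (\<forall>v\<in>V. phi Z v a = 0)"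
proof -
  have "cross Z t \<notin> span (cross Z ` V)"
  proof
    assume "cross Z t \<in> span (cross Z ` V)"
    then obtain v where v: "v \<in> span V" "cross Z t = cross Z v"
      using linear_span_image[OF linear_cross] by auto
    then have "cross Z (t - v) = 0" by (simp add: cross_simps)
    then have "t - v \<in> span {Z}" using assms(1) by (intro cross_eq_0)
    then have "(t - v) + v \<in> span (insert Z V)"
      using v(1) by (intro span_add) (meson span_mono insert_subset subset_insertI subsetD empty_subsetI insertI1)+
    then show False using assms(2) by simp
  qed
  then obtain u where u: "\<And>v. v \<in> cross Z ` V \<Longrightarrow> v \<bullet> u = 0" "cross Z t \<bullet> u \<noteq> 0"
    using in_span_if_orthogonal_annihilator by blast
  show ?thesis
    by (intro exI[of _ "(1 / phi Z t u) *\<^sub>R u"]) (use u in \<open>auto simp: inner_cross[symmetric]\<close>)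
qed

section \<open>Ideals of a nilpotent Lie algebra and flags in the derived algebra\<close>

text \<open>A nonzero ideal of the nilpotent quotient by N meets the centre of that quotient. The
  element is taken from the last term of the lower central series whose intersection with P is not
  inside N; its brackets fall into the next intersection.\<close>

lemma lie_ideal_step:
  assumes "lie_ideal br N" "lie_ideal br P" "\<not> P \<subseteq> N"
  obtains x where "x \<in> P" "x \<notin> N" "\<And>u. br x u \<in> N"
proof -
  obtain k where k: "lower_central br k = {0}" using nilpotent by (auto simp: nilpotent_lie_def)
  define m where "m = (LEAST k. P \<inter> lower_central br k \<subseteq> N)"
  have "P \<inter> lower_central br k \<subseteq> N"
    using k assms(1) by (auto simp: lie_ideal_def subspace_0)
  then have m: "P \<inter> lower_central br m \<subseteq> N" unfolding m_def by (rule LeastI)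
  have "m \<noteq> 0"
  proof
    assume "m = 0"
    then show False using m assms(3) by simp
  qed
  then obtain l where l: "m = Suc l" by (cases m) auto
  have "\<not> P \<inter> lower_central br l \<subseteq> N"
    using not_less_Least[of l "\<lambda>k. P \<inter> lower_central br k \<subseteq> N"] l unfolding m_def by simp
  then obtain x where x: "x \<in> P" "x \<in> lower_central br l" "x \<notin> N" by blast
  have "br x u \<in> N" for u
  proof -
    have "br u x \<in> P" using assms(2) x(1) by (auto simp: lie_ideal_def)
    moreover have "br u x \<in> lower_central br m" unfolding l using x(2) by (auto intro!: span_base)
    ultimately have "br u x \<in> N" using m by blast
    then have "- br u x \<in> N" using assms(1) by (simp add: lie_ideal_def subspace_neg)
    then show ?thesis using br_skew[of x u] by simp
  qed
  then show ?thesis using x that by blast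
qed

definition derived :: "'a set" where
  "derived = span {br x y | x y. True}"

lemma br_in_derived [simp]: "br x y \<in> derived"
  unfolding derived_def by (intro span_base) auto

lemma subspace_derived: "subspace derived"
  by (simp add: derived_def)

lemma lie_ideal_derived: "lie_ideal br derived"
  by (simp add: lie_ideal_def subspace_derived)

lemma derived_subset:
  assumes "subspace S" "\<And>x y. br x y \<in> S"
  shows "derived \<subseteq> S"
  unfolding derived_def by (rule span_minimal) (use assms in auto)

lemma linear_vanishes_on_derived:
  fixes f :: "'a \<Rightarrow> 'b::real_vector"
  assumes "linear f" "\<And>x y. f (br x y) = 0" "z \<in> derived"
  shows "f z = 0"
  using assms unfolding derived_def by (auto elim!: linear_eq_0_on_span[rotated -1])

lemma lie_ideal_span_insert:
  assumes "lie_ideal br (span S)" "\<And>u. br x u \<in> span S"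
  shows "lie_ideal br (span (insert x S))"
  unfolding lie_ideal_def
proof (intro conjI allI impI)
  fix u y assume "y \<in> span (insert x S)"
  then obtain k where "y - k *\<^sub>R x \<in> span S" using span_breakdown_eq by blast
  then have "br u (y - k *\<^sub>R x) \<in> span S" using assms(1) unfolding lie_ideal_def by blast
  moreover have "k *\<^sub>R br u x \<in> span S"
    using assms(2)[of u] br_skew[of u x] by (simp add: span_neg span_scale)
  ultimately have "br u (y - k *\<^sub>R x) + k *\<^sub>R br u x \<in> span S" by (rule span_add)
  then show "br u y \<in> span (insert x S)" using span_mono[of S "insert x S"] by auto
qed simp

lemma derived_flag_step:
  assumes "lie_ideal br (span S)" "S \<subseteq> derived" "dim S < dim derived"
  obtains x where "x \<in> derived" "x \<notin> span S" "\<And>u. br x u \<in> span S"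
    "lie_ideal br (span (insert x S))" "insert x S \<subseteq> derived" "dim (insert x S) = dim S + 1"
proof -
  have "\<not> derived \<subseteq> span S"
    using assms(3) by (metis dim_span dim_subset not_le)
  then obtain x where x: "x \<in> derived" "x \<notin> span S" "\<And>u. br x u \<in> span S"
    using lie_ideal_step[OF assms(1) lie_ideal_derived] by blast
  then show ?thesis
    using that assms lie_ideal_span_insert by (simp add: dim_insert)
qed

lemma derived_eq_span:
  assumes "S \<subseteq> derived" "dim S = dim derived"
  shows "derived = span S"
  using assms subspace_derived by (metis dim_eq_span span_eq_iff subset_antisym eq_refl span_mono span_minimal)

section \<open>A central element outside the derived algebra\<close>

text \<open>Brackets between I and J lie in both ideals and vanish, so an abelian I is central,
  while all brackets lie in J. Any nonzero element of I serves as T.\<close>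

lemma exists_central_of_abelian_factor:
  assumes "lie_ideal br I" "lie_ideal br J" "I \<noteq> {0}" "I \<inter> J = {0}"
    and dec: "\<And>v. \<exists>a\<in>I. \<exists>b\<in>J. v = a + b" and ab: "\<And>a b. a \<in> I \<Longrightarrow> b \<in> I \<Longrightarrow> br a b = 0"
  shows "\<exists>T. (\<forall>x. br T x = 0) \<and> T \<notin> derived"
proof -
  have sub: "subspace I" "subspace J" using assms by (auto simp: lie_ideal_def)
  have IJ: "br a b = 0" "br b a = 0" if "a \<in> I" "b \<in> J" for a b
  proof -
    have "br a b \<in> J" "br b a \<in> I" using assms(1,2) that by (auto simp: lie_ideal_def)
    moreover have "br a b \<in> I" using \<open>br b a \<in> I\<close> br_skew[of a b] sub by (simp add: subspace_neg)
    ultimately show "br a b = 0" using assms(4) by auto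
    then show "br b a = 0" using br_skew[of b a] by simp
  qed
  obtain T where T: "T \<in> I" "T \<noteq> 0" using assms(3) sub subspace_0 by blast
  have "br T x = 0" for x
  proof -
    obtain a b where "a \<in> I" "b \<in> J" "x = a + b" using dec by blast
    then show ?thesis using T ab IJ by simp
  qed
  moreover have "derived \<subseteq> J"
  proof (rule derived_subset[OF sub(2)])
    fix x y
    obtain a b where "a \<in> I" "b \<in> J" "x = a + b" using dec by blast
    moreover obtain a' b' where "a' \<in> I" "b' \<in> J" "y = a' + b'" using dec by blast
    ultimately show "br x y \<in> J" using ab IJ assms(2) by (simp add: lie_ideal_def)
  qed
  ultimately show ?thesis using T assms(4) by blast
qed

text \<open>Of the six brackets in d\<phi>(a, b, z, w) only [a, b] survives: z is central and w lies
  in the other factor.\<close>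

lemma phi_vanishes_across_factors:
  assumes IJ: "\<And>a b. a \<in> I \<Longrightarrow> b \<in> J \<Longrightarrow> br a b = 0"
    and c: "c \<in> span {br a b | a b. a \<in> I \<and> b \<in> I}" and z: "\<And>x. br z x = 0" and w: "w \<in> J"
  shows "phi c z w = 0"
proof -
  have lin: "linear (\<lambda>c. phi c z w)" by (rule linearI) simp_all
  have "phi (br a b) z w = 0" if "a \<in> I" "b \<in> I" for a b
  proof -
    have "br a z = 0" "br b z = 0" using z br_skew[of a z] br_skew[of b z] by simp_all
    then show ?thesis using closed_phi[of a b z w] IJ[OF that(1) w] IJ[OF that(2) w] z by simp
  qed
  then show ?thesis
    using linear_eq_0_on_span[OF lin _ c] by auto
qed

text \<open>By the Jacobi identity [I, I] is itself an ideal, so \<open>lie_ideal_step\<close>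
  applies to it with N = {0}.\<close>

lemma central_in_derived_ideal:
  assumes "lie_ideal br I" "a \<in> I" "b \<in> I" "br a b \<noteq> 0"
  obtains z where "z \<in> span {br a b | a b. a \<in> I \<and> b \<in> I}" "z \<in> I" "z \<noteq> 0" "\<And>x. br z x = 0"
proof -
  let ?S = "{br a b | a b. a \<in> I \<and> b \<in> I}"
  have sub: "?S \<subseteq> I" using assms(1) by (auto simp: lie_ideal_def)
  then have subI: "span ?S \<subseteq> I" using assms(1) by (simp add: lie_ideal_def span_minimal)
  have "lie_ideal br (span ?S)"
    unfolding lie_ideal_def
  proof (intro conjI allI impI)
    fix x y assume y: "y \<in> span ?S"
    have "br x s \<in> span ?S" if s: "s \<in> ?S" for s
    proof -
      obtain a b where ab: "a \<in> I" "b \<in> I" "s = br a b" using s by blast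
      then have "br x a \<in> I" "br x b \<in> I" using assms(1) by (auto simp: lie_ideal_def)
      then have "br (br x a) b \<in> ?S" "br a (br x b) \<in> ?S" using ab by blast+
      then show ?thesis
        unfolding ab(3) jacobi_derivation[of x a b] by (intro span_add span_base)
    qed
    then have "br x ` span ?S \<subseteq> span ?S"
      unfolding linear_span_image[OF linear_br(1), symmetric] by (intro span_minimal) auto
    then show "br x y \<in> span ?S" using y by blast
  qed simp
  moreover have "lie_ideal br {0}" by (auto simp: lie_ideal_def)
  moreover have "\<not> span ?S \<subseteq> {0}"
    using assms(2-4) span_base[of "br a b" ?S] by auto
  ultimately obtain z where "z \<in> span ?S" "z \<notin> {0}" "\<And>u. br z u \<in> {0}"
    using lie_ideal_step by blast
  then show ?thesis using that subI by auto
qed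

lemma exists_central_not_derived:
  assumes "decomposable_lie br"
  shows "\<exists>T. (\<forall>x. br T x = 0) \<and> T \<notin> derived"
proof (rule ccontr)
  assume not: "\<not> ?thesis"
  obtain I J where IJ: "lie_ideal br I" "lie_ideal br J" "I \<noteq> {0}" "J \<noteq> {0}" "I \<inter> J = {0}"
    and dec: "\<And>v. \<exists>a\<in>I. \<exists>b\<in>J. v = a + b"
    using assms unfolding decomposable_lie_def by metis
  have dec': "\<exists>a\<in>J. \<exists>b\<in>I. v = a + b" for v
    using dec[of v] by (metis add.commute)
  obtain a b where ab: "a \<in> I" "b \<in> I" "br a b \<noteq> 0"
    using exists_central_of_abelian_factor[OF IJ(1,2,3,5) dec] not by blast
  obtain c d where cd: "c \<in> J" "d \<in> J" "br c d \<noteq> 0"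
    using exists_central_of_abelian_factor[OF IJ(2,1,4) _ dec'] IJ(5) not by blast
  obtain z where z: "z \<in> span {br a b | a b. a \<in> I \<and> b \<in> I}" "z \<in> I" "z \<noteq> 0" "\<And>x. br z x = 0"
    using central_in_derived_ideal[OF IJ(1) ab] by blast
  obtain w where w: "w \<in> span {br a b | a b. a \<in> J \<and> b \<in> J}" "w \<in> J" "w \<noteq> 0" "\<And>x. br w x = 0"
    using central_in_derived_ideal[OF IJ(2) cd] by blast
  have br0: "br a b = 0" if "a \<in> I" "b \<in> J" for a b
  proof -
    have "br a b \<in> J" "br b a \<in> I" using IJ(1,2) that by (auto simp: lie_ideal_def)
    moreover from this have "br a b \<in> I"
      using br_skew[of a b] IJ(1) by (simp add: lie_ideal_def subspace_neg)
    ultimately show ?thesis using IJ(5) by auto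
  qed
  have br0': "br b a = 0" if "b \<in> J" "a \<in> I" for a b
    using br0[OF that(2,1)] br_skew[of b a] by simp
  \<comment> \<open>The component of x in J is handled by z in [I, I], the component in I by w in
    [J, J], with the factors interchanged.\<close>
  have "phi z w x = 0" for x
  proof -
    obtain a b where x: "a \<in> I" "b \<in> J" "x = a + b" using dec by blast
    have "phi z w b = 0"
      by (rule phi_vanishes_across_factors[OF _ z(1) w(4) x(2)]) (rule br0)
    moreover have "phi w z a = 0"
      by (rule phi_vanishes_across_factors[OF _ w(1) z(4) x(1)]) (rule br0')
    ultimately show ?thesis using x(3) phi_skew(1)[of z w a] by simp
  qed
  then have "w \<in> span {z}" using z(3) by (rule phi_nondegenerate)
  then have "w \<in> I"
    using z(2) IJ(1) by (auto simp: span_singleton lie_ideal_def subspace_scale)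
  then show False using w IJ(5) by auto
qed

end

locale calibrated_lie_central = calibrated_lie +
  fixes T :: 'a
  assumes T_central: "br T x = 0" and T_not_derived: "T \<notin> derived"
begin

section \<open>The derived algebra enlarged by T\<close>

definition M :: "'a set" where "M = span (insert T derived)"

lemma subspace_M: "subspace M"
  by (simp add: M_def)

lemma T_in_M: "T \<in> M" and derived_sub_M: "x \<in> derived \<Longrightarrow> x \<in> M"
  by (auto simp: M_def intro: span_base)

lemma dim_M: "dim M = dim derived + 1"
  using T_not_derived subspace_derived by (simp add: M_def dim_insert span_eq_iff[THEN iffD2])

lemma br_T [simp]: "br T x = 0" "br x T = 0"
  using T_central br_skew[of x T] by simp_all

lemma vanishes_on_MI:
  fixes f :: "'a \<Rightarrow> real"
  assumes "linear f" "f T = 0" "\<And>u v. f (br u v) = 0" "m \<in> M"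
  shows "f m = 0"
proof -
  have "f x = 0" if "x \<in> insert T derived" for x
    using that assms linear_vanishes_on_derived[OF assms(1,3)] by auto
  then show ?thesis
    using linear_eq_0_on_span[OF assms(1) _ assms(4)[unfolded M_def]] by blast
qed

lemma T_independent:
  assumes "S \<subseteq> derived"
  shows "T \<notin> span S"
  using T_not_derived assms subspace_derived span_minimal by blast

text \<open>When T and Z are both central, closedness leaves nothing on the right of
  \<open>phi_central_br\<close>, so \<phi>(T, Z, \<cdot>) kills every bracket; it kills T because
  \<phi> alternates.\<close>

lemma phi_central_M:
  assumes "\<And>x. br Z x = 0" "m \<in> M"
  shows "phi T Z m = 0"
  by (rule vanishes_on_MI[OF linear_phi _ _ assms(2)])
    (use assms(1) phi_central_br[OF T_central, of Z] in simp_all)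

subsection \<open>The dimension of the derived algebra\<close>

lemma ad_coeff1:
  assumes "\<And>u. br Y u \<in> span {Z}" "Z \<noteq> 0"
  obtains lam where "linear lam" "\<And>u. br Y u = lam u *\<^sub>R Z"
proof -
  have "\<forall>u. \<exists>k. br Y u = k *\<^sub>R Z" using assms(1) by (auto simp: span_singleton)
  then obtain lam where lam: "\<And>u. br Y u = lam u *\<^sub>R Z" by metis
  have "linear lam"
  proof (rule linearI)
    fix u v c
    have "lam (u + v) *\<^sub>R Z = (lam u + lam v) *\<^sub>R Z"
      using br_simps(3)[of Y u v] unfolding lam by (simp add: scaleR_left_distrib)
    then show "lam (u + v) = lam u + lam v" using assms(2) by simp
    have "lam (c *\<^sub>R u) *\<^sub>R Z = (c * lam u) *\<^sub>R Z"
      using br_simps(7)[of Y c u] unfolding lam by simp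
    then show "lam (c *\<^sub>R u) = c *\<^sub>R lam u" using assms(2) by simp
  qed
  then show ?thesis using that lam by blast
qed

lemma ad_coeff2:
  assumes "\<And>u. br X u \<in> span {Y, Z}" "Z \<noteq> 0" "Y \<notin> span {Z}"
  obtains tau xi where "linear tau" "linear xi" "\<And>u. br X u = tau u *\<^sub>R Y + xi u *\<^sub>R Z"
proof -
  have "\<exists>a b. br X u = a *\<^sub>R Y + b *\<^sub>R Z" for u
  proof -
    obtain a where "br X u - a *\<^sub>R Y \<in> span {Z}" using assms(1) span_breakdown_eq by blast
    then obtain b where "br X u - a *\<^sub>R Y = b *\<^sub>R Z" by (auto simp: span_singleton)
    then show ?thesis by (metis add.commute diff_add_cancel)
  qed
  then obtain tau xi where t: "\<And>u. br X u = tau u *\<^sub>R Y + xi u *\<^sub>R Z" by metis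
  have "tau (u + v) = tau u + tau v \<and> xi (u + v) = xi u + xi v" for u v
  proof (rule coeff_unique2[OF assms(2,3)])
    show "tau (u + v) *\<^sub>R Y + xi (u + v) *\<^sub>R Z = (tau u + tau v) *\<^sub>R Y + (xi u + xi v) *\<^sub>R Z"
      using br_simps(3)[of X u v] unfolding t by (simp add: algebra_simps)
  qed
  moreover have "tau (c *\<^sub>R u) = c * tau u \<and> xi (c *\<^sub>R u) = c * xi u" for c u
  proof (rule coeff_unique2[OF assms(2,3)])
    show "tau (c *\<^sub>R u) *\<^sub>R Y + xi (c *\<^sub>R u) *\<^sub>R Z = (c * tau u) *\<^sub>R Y + (c * xi u) *\<^sub>R Z"
      using br_simps(7)[of X c u] unfolding t by (simp add: algebra_simps)
  qed
  ultimately have "linear tau" "linear xi" by (auto intro!: linearI)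
  then show ?thesis using that t by blast
qed

lemma derived_flag1:
  assumes "dim derived \<ge> 1"
  shows "\<exists>Z. Z \<in> derived \<and> Z \<noteq> 0 \<and> (\<forall>x. br Z x = 0) \<and> lie_ideal br (span {Z}) \<and> dim {Z} = 1"
proof -
  have "lie_ideal br (span {})" by (auto simp: lie_ideal_def)
  then show ?thesis
    using derived_flag_step[of "{}"] assms by auto
qed

lemma derived_flag2:
  assumes "dim derived \<ge> 2"
  shows "\<exists>Y Z. Z \<in> derived \<and> Z \<noteq> 0 \<and> (\<forall>x. br Z x = 0) \<and> Y \<in> derived \<and> Y \<notin> span {Z}
    \<and> (\<forall>u. br Y u \<in> span {Z}) \<and> lie_ideal br (span {Y, Z}) \<and> dim {Y, Z} = 2"
proof -
  obtain Z where Z: "Z \<in> derived" "Z \<noteq> 0" "\<forall>x. br Z x = 0" "lie_ideal br (span {Z})" "dim {Z} = 1"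
    using derived_flag1 assms by auto
  have "{Z} \<subseteq> derived" "dim {Z} < dim derived" using Z assms by simp_all
  from derived_flag_step[OF Z(4) this] obtain Y where
    "Y \<in> derived" "Y \<notin> span {Z}" "\<forall>u. br Y u \<in> span {Z}" "lie_ideal br (span {Y, Z})"
    "dim {Y, Z} = dim {Z} + 1" by metis
  then show ?thesis using Z by (intro exI[of _ Y] exI[of _ Z]) simp
qed

lemma derived_flag3:
  assumes "dim derived \<ge> 3"
  shows "\<exists>X Y Z. Z \<in> derived \<and> Z \<noteq> 0 \<and> (\<forall>x. br Z x = 0) \<and> Y \<in> derived \<and> Y \<notin> span {Z}
    \<and> (\<forall>u. br Y u \<in> span {Z}) \<and> X \<in> derived \<and> X \<notin> span {Y, Z}
    \<and> (\<forall>u. br X u \<in> span {Y, Z}) \<and> lie_ideal br (span {X, Y, Z}) \<and> dim {X, Y, Z} = 3"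
proof -
  have "dim derived \<ge> 2" using assms by simp
  from derived_flag2[OF this] obtain Y Z where Z: "Z \<in> derived" "Z \<noteq> 0" "\<forall>x. br Z x = 0"
    "Y \<in> derived" "Y \<notin> span {Z}" "\<forall>u. br Y u \<in> span {Z}" "lie_ideal br (span {Y, Z})" "dim {Y, Z} = 2"
    by blast
  have "{Y, Z} \<subseteq> derived" "dim {Y, Z} < dim derived" using Z assms by simp_all
  from derived_flag_step[OF Z(7) this]
  obtain X where "X \<in> derived" "X \<notin> span {Y, Z}" "\<forall>u. br X u \<in> span {Y, Z}" "lie_ideal br (span {X, Y, Z})"
    "dim {X, Y, Z} = dim {Y, Z} + 1" by metis
  then show ?thesis using Z by (intro exI[of _ X] exI[of _ Y] exI[of _ Z]) simp
qed

lemma notin_span_insert_T: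
  assumes "S \<subseteq> derived" "Y \<in> derived" "Y \<notin> span S"
  shows "Y \<notin> span (insert T S)"
proof
  assume "Y \<in> span (insert T S)"
  then obtain k where k: "Y - k *\<^sub>R T \<in> span S" using span_breakdown_eq by blast
  then have "Y - k *\<^sub>R T \<in> derived" using assms(1) subspace_derived span_minimal by blast
  then have "k *\<^sub>R T \<in> derived" using subspace_diff[OF subspace_derived assms(2), of "Y - k *\<^sub>R T"] by simp
  then have "(1 / k) *\<^sub>R (k *\<^sub>R T) \<in> derived" using subspace_derived subspace_scale by blast
  then have "k = 0" using T_not_derived by (cases "k = 0") auto
  then show False using k assms(3) by simp
qed

text \<open>Closedness of \<phi>(Z, \<cdot>, \<cdot>) moves the bracket in \<phi>(Z, Y, [u, v]) onto
  Y, where it becomes a multiple of Z and is annihilated.\<close>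

lemma phi_ZY_M:
  assumes "\<And>x. br Z x = 0" "Y \<in> derived" "\<And>u. br Y u \<in> span {Z}" "m \<in> M"
  shows "phi Z Y m = 0"
proof (rule vanishes_on_MI[OF linear_phi _ _ assms(4)])
  show "phi Z Y T = 0"
    using phi_central_M[OF assms(1) derived_sub_M[OF assms(2)]] phi_rotate[of T Z Y] by simp
  fix u v
  have "phi Z (br Y u) v = 0" for u v
    using assms(3)[of u] by (auto simp: span_singleton)
  then show "phi Z Y (br u v) = 0" using phi_central_br[OF assms(1)] by simp
qed

text \<open>The 3-space spanned by T, Y, Z is isotropic against M, and 3 + 6 exceeds the bound
  8.\<close>

lemma dim_derived_le_4: "dim derived \<le> 4"
proof (rule ccontr)
  assume "\<not> ?thesis"
  then have d: "dim derived \<ge> 5" and "dim derived \<ge> 2" by simp_all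
  from derived_flag2[OF this(2)] obtain Y Z where Z: "Z \<in> derived" "Z \<noteq> 0" "\<And>x. br Z x = 0"
    and Y: "Y \<in> derived" "Y \<notin> span {Z}" "\<And>u. br Y u \<in> span {Z}" "dim {Y, Z} = 2" by blast
  have "phi Z u m = 0" if u: "u \<in> span {T, Y, Z}" and m: "m \<in> M" for u m
  proof -
    have "linear (\<lambda>u. phi Z u m)" by (rule linearI) simp_all
    moreover have "phi Z x m = 0" if "x \<in> {T, Y, Z}" for x
      using that phi_ZY_M[OF Z(3) Y(1,3) m] phi_central_M[OF Z(3) m] phi_skew(1)[of Z T m] by auto
    ultimately show ?thesis using linear_eq_0_on_span u by blast
  qed
  then have "dim (span {T, Y, Z}) + dim M \<le> 8"
    by (intro dim_isotropic_le[OF Z(2)] subspace_M) simp_all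
  moreover have "dim {T, Y, Z} = 3"
    using T_independent[of "{Y, Z}"] Y(1,4) Z(1) by (simp add: dim_insert[of T])
  ultimately show False using d dim_M by simp
qed

text \<open>With \<open>[Y, u] = \<lambda>(u)Z\<close>, \<open>[X, u] = \<tau>(u)Y + \<xi>(u)Z\<close> and \<open>\<gamma> = \<phi>(T, Z, \<cdot>)\<close>, closedness forces
  \<open>\<tau> = c\<gamma>\<close> and \<open>c\<close> to equal its own negative, whereas nondegeneracy forces \<open>\<tau> \<noteq> 0\<close>.\<close>
lemma dim_derived_ne_4: "dim derived \<noteq> 4"
proof
  assume d: "dim derived = 4"
  then have "dim derived \<ge> 3" by simp
  from derived_flag3[OF this] obtain X Y Z where Z: "Z \<in> derived" "Z \<noteq> 0" "\<And>x. br Z x = 0"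
    and Y: "Y \<in> derived" "Y \<notin> span {Z}" "\<And>u. br Y u \<in> span {Z}"
    and X: "X \<in> derived" "X \<notin> span {Y, Z}" "\<And>u. br X u \<in> span {Y, Z}"
      "lie_ideal br (span {X, Y, Z})" "dim {X, Y, Z} = 3" by blast
  define P where "P = span {X, Y, Z}"
  have "{X, Y, Z} \<subseteq> derived" "dim {X, Y, Z} < dim derived" using X Y Z d by simp_all
  from derived_flag_step[OF X(4) this]
  obtain W where W: "W \<in> derived" "W \<notin> P" "\<And>u. br W u \<in> P" "dim {W, X, Y, Z} = dim {X, Y, Z} + 1"
    unfolding P_def by metis
  have P: "subspace P" "lie_ideal br P" using X(4) by (auto simp: P_def)
  have D: "derived = span {W, X, Y, Z}"
    using d Z(1) Y(1) X(1,5) W(1,4) by (intro derived_eq_span) simp_all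
  obtain lam where lam: "linear lam" "\<And>u. br Y u = lam u *\<^sub>R Z"
    using ad_coeff1[OF Y(3) Z(2)] by blast
  obtain tau xi where tx: "linear tau" "linear xi" "\<And>u. br X u = tau u *\<^sub>R Y + xi u *\<^sub>R Z"
    using ad_coeff2[OF X(3) Z(2) Y(2)] by blast
  define gam where "gam = phi T Z"
  have gam: "linear gam" by (simp add: gam_def linear_phi)
  have brZ: "br x Z = 0" for x using Z(3) br_skew[of x Z] by simp
  have gamM: "gam m = 0" if "m \<in> M" for m
    using phi_central_M[OF Z(3) that] by (simp add: gam_def)
  have lamM: "lam m = 0" if "m \<in> M" for m
  proof (rule vanishes_on_MI[OF lam(1) _ _ that])
    show "lam T = 0" using lam(2)[of T] Z(2) by simp
    fix u v
    have "lam (br u v) *\<^sub>R Z = br (br Y u) v + br u (br Y v)"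
      using lam(2)[of "br u v"] jacobi_derivation[of Y u v] by simp
    also have "\<dots> = 0" using Z(3) brZ by (simp add: lam(2))
    finally show "lam (br u v) = 0" using Z(2) by simp
  qed
  have TY: "phi T Y (br u v) = lam u * gam v - lam v * gam u" for u v
    using phi_central_br[OF T_central, of Y u v] by (simp add: lam(2) gam_def)
  \<comment> \<open>Otherwise \<phi>(T, Y, \<cdot>) also vanishes on M, and the triple Z, Y, T
    bounds dim M by 4, while dim M = 5.\<close>
  have "\<exists>u v. lam u * gam v - lam v * gam u \<noteq> 0"
  proof (rule ccontr)
    assume "\<not> ?thesis"
    then have TY0: "phi T Y (br u v) = 0" for u v using TY by simp
    have TYM: "phi T Y m = 0" if "m \<in> M" for m
      by (rule vanishes_on_MI[OF linear_phi _ _ that]) (simp_all add: TY0)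
    have "dim M \<le> 4"
    proof (rule dim_triple_le[of Z Y T])
      show "T \<notin> span {Z, Y}" using Z(1) Y(1) by (intro T_independent) simp
      show "phi Z Y m = 0" if "m \<in> M" for m using phi_ZY_M[OF Z(3) Y(1,3) that] .
      show "phi Z T m = 0" if "m \<in> M" for m using gamM[OF that] phi_skew(1)[of Z T m] by (simp add: gam_def)
      show "phi Y T m = 0" if "m \<in> M" for m using TYM[OF that] phi_skew(1)[of Y T m] by simp
    qed (use Z(2) Y(2) subspace_M in auto)
    then show False using dim_M d by simp
  qed
  then obtain u0 v0 where uv0: "lam u0 * gam v0 - lam v0 * gam u0 \<noteq> 0" by blast
  define k where "k = lam u0 * gam v0 - lam v0 * gam u0"
  have k: "k \<noteq> 0" using uv0 by (simp add: k_def)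
  \<comment> \<open>Otherwise X behaves like Y, and the 4-space spanned by T, X, Y, Z is isotropic
    against the 5-dimensional M.\<close>
  have "\<exists>u. tau u \<noteq> 0"
  proof (rule ccontr)
    assume "\<not> ?thesis"
    then have X': "br X u = xi u *\<^sub>R Z" for u using tx(3) by simp
    have ZX: "phi Z X m = 0" if "m \<in> M" for m
      by (rule phi_ZY_M[OF Z(3) X(1) _ that]) (simp add: X' span_base span_scale)
    have "phi Z u m = 0" if u: "u \<in> span {T, X, Y, Z}" and m: "m \<in> M" for u m
    proof -
      have "linear (\<lambda>u. phi Z u m)" by (rule linearI) simp_all
      moreover have "phi Z x m = 0" if "x \<in> {T, X, Y, Z}" for x
        using that phi_ZY_M[OF Z(3) Y(1,3) m] phi_central_M[OF Z(3) m] phi_skew(1)[of Z T m] ZX[OF m] by auto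
      ultimately show ?thesis using linear_eq_0_on_span u by blast
    qed
    then have "dim (span {T, X, Y, Z}) + dim M \<le> 8"
      by (intro dim_isotropic_le[OF Z(2)] subspace_M) simp_all
    moreover have "dim {T, X, Y, Z} = 4"
      using T_independent[of "{X, Y, Z}"] X(1,5) Y(1) Z(1) by (simp add: dim_insert[of T])
    ultimately show False using d dim_M by simp
  qed
  then obtain u1 where u1: "tau u1 \<noteq> 0" by blast
  define N where "N = {u. lam u = 0 \<and> gam u = 0}"
  have subN: "subspace N"
    unfolding N_def subspace_def using lam(1) gam
    by (auto simp: linear_0 linear_add linear_scale)
  \<comment> \<open>u0 and v0 are independent modulo N, so dim N \<le> 5 = dim M. Hence u0 and v0
    span a complement of M.\<close>
  have "M = N"
  proof (rule subspace_dim_equal[OF subspace_M subN])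
    show "M \<subseteq> N" using lamM gamM by (auto simp: N_def)
    have u0: "u0 \<notin> span N" using uv0 subN by (auto simp: N_def span_eq_iff[THEN iffD2])
    have v0: "v0 \<notin> span (insert u0 N)"
    proof
      assume "v0 \<in> span (insert u0 N)"
      then obtain c where "v0 - c *\<^sub>R u0 \<in> N"
        using span_breakdown_eq subN by (metis span_eq_iff)
      then have "lam v0 = c * lam u0" "gam v0 = c * gam u0"
        using lam(1) gam by (simp_all add: N_def linear_diff linear_scale)
      then show False using uv0 by simp
    qed
    have "dim N + 2 = dim (insert v0 (insert u0 N))" using u0 v0 by (simp add: dim_insert)
    also have "\<dots> \<le> 7" using dim_subset_UNIV dim7 by metis
    finally show "dim N \<le> dim M" using dim_M d by simp
  qed
  have brM: "br m u \<in> P" if "m \<in> M" for m u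
  proof -
    have "br x u \<in> P" if "x \<in> {W, X, Y, Z}" for x
    proof -
      have "br u y \<in> P" if "y \<in> {X, Y, Z}" for y
        using P(2) that span_base[of y "{X,Y,Z}"] unfolding lie_ideal_def P_def by blast
      then have "br y u \<in> P" if "y \<in> {X, Y, Z}" for y
        using that P(1) subspace_neg br_skew by metis
      then show ?thesis using that W(3) by blast
    qed
    then have "(\<lambda>m. br m u) ` derived \<subseteq> P"
      unfolding D linear_span_image[OF linear_br(2), symmetric]
      by (intro span_minimal P) auto
    then have "(\<lambda>m. br m u) ` insert T derived \<subseteq> P" using P(1) by (simp add: subspace_0)
    then have "(\<lambda>m. br m u) ` M \<subseteq> P"
      unfolding M_def linear_span_image[OF linear_br(2), symmetric] by (intro span_minimal P)
    then show ?thesis using that by blast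
  qed
  have brM': "br u m \<in> P" if "m \<in> M" for m u
    using brM[OF that] br_skew[of u m] P(1) by (simp add: subspace_neg)
  define W0 where "W0 = br u0 v0"
  have comb: "k *\<^sub>R br u v - phi T Y (br u v) *\<^sub>R W0 \<in> P" for u v
  proof -
    \<comment> \<open>Cramer coefficients of u along u0 and v0, multiplied by the determinant
      \<open>k\<close> to avoid division; the remainder \<open>n u\<close> lies in M. Since brackets
      with M fall into P, modulo P every bracket is a multiple of W0, and \<phi>(T, Y, \<cdot>)
      reads off the factor.\<close>
    define al where "al u = lam u * gam v0 - lam v0 * gam u" for u
    define be where "be u = lam u0 * gam u - lam u * gam u0" for u
    define n where "n u = k *\<^sub>R u - al u *\<^sub>R u0 - be u *\<^sub>R v0" for u
    have n: "n u \<in> M" for u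
      unfolding \<open>M = N\<close> N_def n_def al_def be_def k_def using lam(1) gam
      by (simp add: linear_diff linear_scale) (simp add: algebra_simps)
    have ku: "k *\<^sub>R u = al u *\<^sub>R u0 + be u *\<^sub>R v0 + n u" for u by (simp add: n_def)
    have "(k * k) *\<^sub>R br u v = br (k *\<^sub>R u) (k *\<^sub>R v)" by simp
    also have "\<dots> = br (al u *\<^sub>R u0 + be u *\<^sub>R v0) (al v *\<^sub>R u0 + be v *\<^sub>R v0)
        + (br (n u) (k *\<^sub>R v) + br (al u *\<^sub>R u0 + be u *\<^sub>R v0) (n v))"
      unfolding ku[of u] ku[of v] by (simp only: br_simps(2,3)) (simp add: algebra_simps)
    also have "br (al u *\<^sub>R u0 + be u *\<^sub>R v0) (al v *\<^sub>R u0 + be v *\<^sub>R v0) = (al u * be v - be u * al v) *\<^sub>R W0"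
      using br_skew[of v0 u0] by (simp add: W0_def algebra_simps)
    also have "al u * be v - be u * al v = k * phi T Y (br u v)"
      unfolding TY al_def be_def k_def by (simp add: algebra_simps)
    finally have "k *\<^sub>R (k *\<^sub>R br u v - phi T Y (br u v) *\<^sub>R W0) = br (n u) (k *\<^sub>R v) + br (al u *\<^sub>R u0 + be u *\<^sub>R v0) (n v)"
      by (simp add: scaleR_diff_right algebra_simps)
    also have "\<dots> \<in> P" by (rule subspace_add[OF P(1) brM[OF n] brM'[OF n]])
    finally have "(1 / k) *\<^sub>R (k *\<^sub>R (k *\<^sub>R br u v - phi T Y (br u v) *\<^sub>R W0)) \<in> P"
      using P(1) subspace_scale by blast
    then show ?thesis using k by simp
  qed
  have combD: "k *\<^sub>R E - phi T Y E *\<^sub>R W0 \<in> P" if "E \<in> derived" for E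
  proof -
    have lin: "linear (\<lambda>E. k *\<^sub>R E - phi T Y E *\<^sub>R W0)"
      by (rule linearI) (simp_all add: algebra_simps)
    have "(\<lambda>E. k *\<^sub>R E - phi T Y E *\<^sub>R W0) ` derived \<subseteq> P"
      unfolding derived_def linear_span_image[OF lin, symmetric]
      using comb by (intro span_minimal P) auto
    then show ?thesis using that by blast
  qed
  \<comment> \<open>Otherwise \<open>combD\<close> at X puts W0 into P, and then
    \<open>combD\<close> at W puts W into P.\<close>
  have TYX: "phi T Y X = 0"
  proof (rule ccontr)
    assume h: "phi T Y X \<noteq> 0"
    have "X \<in> P" by (simp add: P_def span_base)
    then have "k *\<^sub>R X - (k *\<^sub>R X - phi T Y X *\<^sub>R W0) \<in> P"
      by (rule subspace_diff[OF P(1) subspace_scale[OF P(1)] combD[OF X(1)]])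
    then have "phi T Y X *\<^sub>R W0 \<in> P" by simp
    from subspace_scale[OF P(1) this, of "1 / phi T Y X"] have "W0 \<in> P" using h by simp
    then have "(k *\<^sub>R W - phi T Y W *\<^sub>R W0) + phi T Y W *\<^sub>R W0 \<in> P"
      by (rule subspace_add[OF P(1) combD[OF W(1)] subspace_scale[OF P(1)]])
    then have "k *\<^sub>R W \<in> P" by simp
    from subspace_scale[OF P(1) this, of "1 / k"] have "W \<in> P" using k by simp
    then show False using W(2) k by simp
  qed
  have xi0: "tau W0 = 0 \<and> xi W0 = tau u0 * lam v0 - tau v0 * lam u0"
  proof (rule coeff_unique2[OF Z(2) Y(2)])
    have "tau W0 *\<^sub>R Y + xi W0 *\<^sub>R Z = br (br X u0) v0 + br u0 (br X v0)"
      using jacobi_derivation[of X u0 v0] by (simp add: W0_def tx(3)[symmetric])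
    also have "\<dots> = tau u0 *\<^sub>R br Y v0 + tau v0 *\<^sub>R br u0 Y"
      by (simp add: tx(3) Z(3) brZ)
    also have "\<dots> = 0 *\<^sub>R Y + (tau u0 * lam v0 - tau v0 * lam u0) *\<^sub>R Z"
      using br_skew[of u0 Y] by (simp add: lam(2) algebra_simps)
    finally show "tau W0 *\<^sub>R Y + xi W0 *\<^sub>R Z = 0 *\<^sub>R Y + (tau u0 * lam v0 - tau v0 * lam u0) *\<^sub>R Z" .
  qed
  \<comment> \<open>[u, W0] lies in P, on which \<phi>(T, X, \<cdot>) vanishes because of
    \<open>TYX\<close>; closedness expands this zero. The constant c with \<tau> = c\<gamma> is thus
    \<xi>(W0) / k.\<close>
  have main: "tau u * k = xi W0 * gam u" for u
  proof -
    have "W0 \<in> M" by (simp add: W0_def derived_sub_M)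
    then have "br u W0 \<in> P" by (rule brM')
    moreover have "phi T X x = 0" if "x \<in> {X, Y, Z}" for x
      using that TYX phi_skew(2)[of T X Y] phi_skew(2)[of T X Z] gamM[OF derived_sub_M[OF X(1)]]
      by (auto simp: gam_def)
    ultimately have "phi T X (br u W0) = 0"
      unfolding P_def using linear_eq_0_on_span[OF linear_phi] by blast
    moreover have "phi T X (br u W0) = phi T (br X u) W0 - phi T (br X W0) u"
      by (rule phi_central_br[OF T_central])
    moreover have "phi T Z W0 = 0" using gamM[OF \<open>W0 \<in> M\<close>] by (simp add: gam_def)
    moreover have "phi T Y W0 = k" by (simp add: W0_def TY k_def)
    ultimately show ?thesis using xi0 by (simp add: tx(3) gam_def)
  qed
  \<comment> \<open>Inserting \<tau> = c\<gamma> into the Jacobi formula for \<xi>(W0) reproduces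
    the determinant \<open>k\<close> with the opposite sign.\<close>
  have "k * xi W0 = xi W0 * gam u0 * lam v0 - xi W0 * gam v0 * lam u0"
  proof -
    have "k * xi W0 = (tau u0 * k) * lam v0 - (tau v0 * k) * lam u0" using xi0 by (simp add: right_diff_distrib mult.commute mult.left_commute)
    then show ?thesis unfolding main by (simp add: algebra_simps)
  qed
  also have "\<dots> = - k * xi W0" by (simp add: k_def algebra_simps)
  finally have "xi W0 = 0" using k by simp
  then show False using main[of u1] u1 k by simp
qed

section \<open>Derived algebras of dimension 1, 2 and 3\<close>

text \<open>Two functionals have a common kernel of dimension at least 5, and 5 + 5 > 8.\<close>

lemma no_isotropic_codim_2:
  fixes f g :: "'a \<Rightarrow> real"
  assumes "Z \<noteq> 0" "linear f" "linear g" "\<And>x y. f x = 0 \<Longrightarrow> g x = 0 \<Longrightarrow> f y = 0 \<Longrightarrow> g y = 0 \<Longrightarrow> phi Z x y = 0"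
  shows False
proof -
  let ?A = "{u \<in> UNIV. f u = 0}" and ?N = "{u \<in> {u \<in> UNIV. f u = 0}. g u = 0}"
  have A: "subspace ?A" and N: "subspace ?N"
    using assms(2,3) by (auto simp: subspace_def linear_0 linear_add linear_scale)
  have "7 \<le> dim ?A + 1" using dim_kernel_functional[OF assms(2) subspace_UNIV] dim7 by simp
  moreover have "dim ?A \<le> dim ?N + 1" by (rule dim_kernel_functional[OF assms(3) A])
  moreover have "dim ?N + dim ?N \<le> 8"
    using assms(4) by (intro dim_isotropic_le[OF assms(1) N N]) auto
  ultimately show False by linarith
qed

text \<open>The isotropic subspace has codimension 2 and consists of central elements.\<close>
lemma dim_derived_ne_1: "dim derived \<noteq> 1"
proof
  assume d: "dim derived = 1"
  have "dim derived \<ge> 1" using d by simp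
  from derived_flag1[OF this] obtain Z where Z: "Z \<in> derived" "Z \<noteq> 0" "\<And>x. br Z x = 0" "dim {Z} = 1"
    by blast
  have D: "derived = span {Z}" using Z d by (intro derived_eq_span) auto
  have "T \<notin> span {Z}" using T_not_derived D by simp
  then obtain w where "phi Z T w = 1" using dual_vector[of Z T "{}"] Z(2) by auto
  then have w: "phi T Z w \<noteq> 0" using phi_skew(1)[of Z T w] by simp
  obtain z where z: "linear z" "\<And>u. br w u = z u *\<^sub>R Z"
    using ad_coeff1[of w Z] D Z(2) br_in_derived by metis
  \<comment> \<open>In \<phi>(T, c, [v, w]) = \<phi>(T, [c, v], w) - \<phi>(T, [c, w], v) the left
    side is a multiple of \<phi>(T, c, Z) = 0 and [c, w] = 0, so the coefficient of [c, v] along Z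
    vanishes.\<close>
  have central: "br c v = 0" if c: "phi T Z c = 0" "z c = 0" for c v
  proof -
    have s: "\<exists>s. br u v = s *\<^sub>R Z" for u v
      using br_in_derived[of u v] D by (auto simp: span_singleton)
    obtain r where r: "br v w = r *\<^sub>R Z" using s by blast
    obtain t where t: "br c v = t *\<^sub>R Z" using s by blast
    have "br c w = 0" using z(2)[of c] c br_skew[of c w] by simp
    moreover have "phi T c Z = 0" using c(1) phi_skew(2)[of T c Z] by simp
    ultimately have "t * phi T Z w = 0"
      using phi_central_br[OF T_central, of c v w] by (simp add: r t)
    then show ?thesis using w t by simp
  qed
  have "\<not> derived \<subseteq> {0}" using Z by blast
  then obtain a b where "br a b \<noteq> 0" using derived_subset[of "{0}"] by auto
  moreover obtain s where s: "br a b = s *\<^sub>R Z"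
    using br_in_derived[of a b] D by (auto simp: span_singleton)
  ultimately have "s \<noteq> 0" by auto
  show False
  proof (rule no_isotropic_codim_2[OF Z(2) linear_phi[of T Z] z(1)])
    fix x y assume h: "phi T Z x = 0" "z x = 0" "phi T Z y = 0" "z y = 0"
    have "phi x y (br a b) = 0"
      using phi_central_br[OF central[OF h(1,2)], of y a b] central[OF h(3,4)] by simp
    then show "phi Z x y = 0" using s \<open>s \<noteq> 0\<close> phi_rotate[of Z x y] by simp
  qed
qed

text \<open>If \<open>[Y, u] = \<lambda>(u)Z\<close> with \<open>\<lambda> \<noteq> 0\<close>, the common kernel of \<open>\<lambda>\<close> and \<open>\<phi>(Z, Y, \<cdot>)\<close> is isotropic for
  \<open>\<phi>(Z, \<cdot>, \<cdot>)\<close>, which its dimension 5 does not allow.\<close>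
lemma dim_derived_2_central:
  assumes d: "dim derived = 2"
  obtains Y Z where "Z \<noteq> 0" "Y \<notin> span {Z}" "derived = span {Y, Z}" "\<And>x. br Y x = 0" "\<And>x. br Z x = 0"
proof -
  have "dim derived \<ge> 2" using d by simp
  from derived_flag2[OF this] obtain Y Z where Z: "Z \<in> derived" "Z \<noteq> 0" "\<And>x. br Z x = 0"
    and Y: "Y \<in> derived" "Y \<notin> span {Z}" "\<And>u. br Y u \<in> span {Z}" "dim {Y, Z} = 2" by blast
  have D: "derived = span {Y, Z}"
    using d Z(1) Y(1,4) by (intro derived_eq_span) auto
  obtain lam where lam: "linear lam" "\<And>u. br Y u = lam u *\<^sub>R Z"
    using ad_coeff1[OF Y(3) Z(2)] by blast
  have brZ: "br x Z = 0" for x using Z(3) br_skew[of x Z] by simp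
  have brY': "br x Y = - lam x *\<^sub>R Z" for x using lam(2) br_skew[of x Y] by simp
  have "lam u1 = 0" for u1
  proof (rule ccontr)
    assume u1: "lam u1 \<noteq> 0"
    have "\<exists>a b. br u v = a *\<^sub>R Y + b *\<^sub>R Z" for u v
      using ad_coeff2[of u Y Z] D br_in_derived Z(2) Y(2) by metis
    then obtain y z where yz: "\<And>u v. br u v = y u v *\<^sub>R Y + z u v *\<^sub>R Z" by metis
    define gam where "gam = phi T Z"
    define psi where "psi = phi Z Y"
    have lg: "lam v * gam w = lam w * gam v" for v w
    proof -
      have "phi T Y (br v w) = 0"
        using phi_central_M[OF Z(3) derived_sub_M[OF Y(1)]] phi_skew(2)[of T Y Z] by (simp add: yz)
      then show ?thesis
        using phi_central_br[OF T_central, of Y v w] by (simp add: lam(2) gam_def)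
    qed
    have "Y \<notin> span {Z, T}"
      using notin_span_insert_T[of "{Z}" Y] Z(1) Y(1,2) by (simp add: insert_commute)
    then obtain w where w: "psi w = 1" "phi Z T w = 0"
      using dual_vector[of Z Y "{T}"] Z(2) unfolding psi_def by auto
    have "T \<notin> span {Z, Y}" using T_not_derived D by (simp add: insert_commute)
    then obtain v1 where v1: "phi Z T v1 = 1" "psi v1 = 0"
      using dual_vector[of Z T "{Y}"] Z(2) unfolding psi_def by auto
    have g: "gam w = 0" "gam v1 = - 1"
      using w(2) v1(1) phi_skew(1)[of T Z] by (simp_all add: gam_def)
    then have lv1: "lam v1 \<noteq> 0" using lg[of u1 v1] u1 by auto
    then have lw: "lam w = 0" using lg[of v1 w] g by simp
    \<comment> \<open>Brackets with n stay in the line of Z. The Jacobi relation \<open>L\<close>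
      gives this for [n, w], as \<lambda>(w) = 0 and \<lambda>(v1) \<noteq> 0; the closedness
      relation \<open>P\<close> carries it to every v, as \<psi>(w) = 1.\<close>
    have y0: "y n v = 0" if n: "lam n = 0" "psi n = 0" for n v
    proof -
      have P: "y n v * psi w' = y n w' * psi v" for v w'
      proof -
        have "phi Z n Y = 0" using n(2) phi_skew(2)[of Z n Y] by (simp add: psi_def)
        then show ?thesis
          using phi_central_br[OF Z(3), of n v w'] by (simp add: yz psi_def)
      qed
      have L: "y n v * lam w' = y n w' * lam v" for v w'
      proof -
        have "br n (br v w') = 0" by (simp add: yz[of v w'] brY' n(1) brZ)
        moreover have "br n (br v w') = (y n v * lam w') *\<^sub>R Z - (y n w' * lam v) *\<^sub>R Z"
          unfolding jacobi_derivation[of n v w'] yz[of n v] yz[of n w'] by (simp add: lam(2) brY' Z(3) brZ)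
        ultimately have "(y n v * lam w' - y n w' * lam v) *\<^sub>R Z = 0" by (simp add: scaleR_left_diff_distrib)
        then show ?thesis using Z(2) by simp
      qed
      have "y n w = 0" using L[of v1 w] lw lv1 by simp
      then show ?thesis using P[of v w] w(1) by simp
    qed
    show False
    proof (rule no_isotropic_codim_2[OF Z(2) lam(1), of psi])
      show "linear psi" by (simp add: psi_def linear_phi)
      fix m n assume m: "lam m = 0" "psi m = 0" and n: "lam n = 0" "psi n = 0"
      have "br m u = z m u *\<^sub>R Z" "br n u = z n u *\<^sub>R Z" for u
        using yz y0[OF m] y0[OF n] by simp_all
      \<comment> \<open>In d\<phi>(Y, m, n, v1) the brackets [m, n], [m, v1], [n, v1] are multiples
        of Z, and \<psi> kills v1, n, m; only [Y, v1] contributes.\<close>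
      then have "lam v1 * phi Z m n = 0"
        using closed_phi[of Y m n v1] m n v1(2) by (simp add: lam(2) psi_def)
      then show "phi Z m n = 0" using lv1 by simp
    qed
  qed
  then show ?thesis using that Z Y D lam by auto
qed

text \<open>Closedness of \<phi>(T, \<cdot>, \<cdot>) and \<phi>(X, \<cdot>, \<cdot>) at Y makes
  \<lambda> proportional to both \<phi>(T, Z, \<cdot>) and \<phi>(Z, X, \<cdot>). These are
  independent because T, X, Z are, so \<lambda> = 0. That X, Y, Z exhaust the derived algebra is
  stated through functionals, which is easy to check after a change of basis.\<close>

lemma central_of_two_central_directions:
  assumes XYZ: "X \<in> derived" "Y \<in> derived" "Z \<in> derived" "Z \<noteq> 0" "X \<notin> span {Z}"
    and D: "\<And>f :: 'a \<Rightarrow> real. \<And>x. linear f \<Longrightarrow> f X = 0 \<Longrightarrow> f Y = 0 \<Longrightarrow> f Z = 0 \<Longrightarrow> x \<in> derived \<Longrightarrow> f x = 0"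
    and brZ: "\<And>u. br Z u = 0" and brX: "\<And>u. br X u = 0" and brY: "\<And>u. br Y u = lam u *\<^sub>R Z"
  shows "lam u = 0"
proof -
  have TZ: "phi T Z m = 0" if "m \<in> derived" for m using phi_central_M[OF brZ] derived_sub_M that by blast
  have ZX: "phi Z X m = 0" if "m \<in> derived" for m
    using phi_ZY_M[OF brZ XYZ(1) _ derived_sub_M[OF that]] brX by (simp add: span_0)
  have "phi T Y x = 0" if "x \<in> derived" for x
  proof (rule D[OF linear_phi _ _ _ that])
    show "phi T Y X = 0"
      using phi_central_M[OF brX derived_sub_M[OF XYZ(2)]] phi_skew(2)[of T Y X] by simp
    show "phi T Y Z = 0" using TZ[OF XYZ(2)] phi_skew(2)[of T Y Z] by simp
  qed simp
  then have G: "lam u * phi T Z v = lam v * phi T Z u" for u v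
    using phi_central_br[OF T_central, of Y u v] by (simp add: brY)
  have "phi X Y x = 0" if "x \<in> derived" for x
  proof (rule D[OF linear_phi _ _ _ that])
    show "phi X Y Z = 0" using ZX[OF XYZ(2)] phi_rotate[of Z X Y] by simp
  qed simp_all
  then have "lam u * phi X Z v = lam v * phi X Z u" for u v
    using phi_central_br[OF brX, of Y u v] by (simp add: brY)
  then have H: "lam u * phi Z X v = lam v * phi Z X u" for u v
    using phi_skew(1)[of X Z] by simp
  have "T \<notin> span {Z, X}" using XYZ by (intro T_independent) simp
  then obtain a where a: "phi Z T a = 1" "phi Z X a = 0"
    using dual_vector[of Z T "{X}"] XYZ(4) by auto
  have "X \<notin> span {Z, T}"
    using notin_span_insert_T[of "{Z}" X] XYZ by (simp add: insert_commute)
  then obtain b where b: "phi Z X b = 1" "phi Z T b = 0"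
    using dual_vector[of Z X "{T}"] XYZ(4) by auto
  have "lam b = 0" using G[of b a] a b phi_skew(1)[of T Z] by simp
  then show ?thesis using H[of u b] b by simp
qed

text \<open>The functionals \<open>\<gamma> = \<phi>(T, Z, \<cdot>)\<close>, \<open>\<psi> = \<phi>(Z, Y, \<cdot>)\<close>, \<open>\<theta> = \<phi>(Z, X, \<cdot>)\<close> form a basis of the annihilator
  of \<open>M = D + \<langle>T\<rangle>\<close>. On a dual basis a, b, c the Jacobi identity and the closedness conditions become
  equations between real numbers.\<close>
lemma dim_derived_3_central:
  assumes d: "dim derived = 3" and W: "W \<in> derived"
  shows "br W u = 0"
proof -
  have "dim derived \<ge> 3" using d by simp
  from derived_flag3[OF this] obtain X Y Z where Z: "Z \<in> derived" "Z \<noteq> 0" "\<And>x. br Z x = 0"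
    and Y: "Y \<in> derived" "Y \<notin> span {Z}" "\<And>u. br Y u \<in> span {Z}"
    and X: "X \<in> derived" "X \<notin> span {Y, Z}" "\<And>u. br X u \<in> span {Y, Z}"
      "dim {X, Y, Z} = 3" by blast
  have D: "derived = span {X, Y, Z}"
    using d Z(1) Y(1) X(1,4) by (intro derived_eq_span) simp_all
  have D0: "f x = 0" if "linear f" "f X = 0" "f Y = 0" "f Z = 0" "x \<in> derived" for f :: "'a \<Rightarrow> real" and x
    using linear_eq_0_on_span[OF that(1) _ that(5)[unfolded D]] that by blast
  obtain lam where lam: "linear lam" "\<And>u. br Y u = lam u *\<^sub>R Z"
    using ad_coeff1[OF Y(3) Z(2)] by blast
  obtain tau xi where tx: "linear tau" "linear xi" "\<And>u. br X u = tau u *\<^sub>R Y + xi u *\<^sub>R Z"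
    using ad_coeff2[OF X(3) Z(2) Y(2)] by blast
  have brZ: "br x Z = 0" for x using Z(3) br_skew[of x Z] by simp
  have brY': "br x Y = - lam x *\<^sub>R Z" for x using lam(2) br_skew[of x Y] by simp
  have brX': "br x X = - tau x *\<^sub>R Y - xi x *\<^sub>R Z" for x using tx(3) br_skew[of x X] by simp
  define gam where "gam = phi T Z"
  define psi where "psi = phi Z Y"
  define th where "th = phi Z X"
  have lin: "linear gam" "linear psi" "linear th" by (simp_all add: gam_def psi_def th_def linear_phi)
  have gamM: "gam m = 0" if "m \<in> M" for m
    using phi_central_M[OF Z(3) that] by (simp add: gam_def)
  have psiM: "psi m = 0" if "m \<in> M" for m
    using phi_ZY_M[OF Z(3) Y(1,3) that] by (simp add: psi_def)
  have thD: "th x = 0" if "x \<in> derived" for x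
  proof (rule D0[OF lin(3) _ _ _ that])
    show "th Y = 0" using psiM[OF derived_sub_M[OF X(1)]] phi_skew(2)[of Z X Y] by (simp add: th_def psi_def)
  qed (simp_all add: th_def)
  have "th T = 0" using gamM[OF derived_sub_M[OF X(1)]] phi_rotate[of T Z X] by (simp add: th_def gam_def)
  then have thM: "th m = 0" if "m \<in> M" for m
    using vanishes_on_MI[OF lin(3) _ _ that] thD by simp
  obtain a where a: "gam a = 1" "psi a = 0" "th a = 0"
  proof -
    have "T \<notin> span {Z, Y, X}" using X Y Z by (intro T_independent) simp
    then obtain a where "phi Z T a = 1" "phi Z Y a = 0" "phi Z X a = 0"
      using dual_vector[of Z T "{Y, X}"] Z(2) by auto
    then show ?thesis
      \<comment> \<open>The sign enters because \<gamma> is \<phi>(T, Z, \<cdot>), while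
        \<open>dual_vector\<close> normalises \<phi>(Z, T, \<cdot>).\<close>
      using that[of "- a"] phi_skew(1)[of T Z a] by (simp add: gam_def psi_def th_def)
  qed
  obtain b where b: "gam b = 0" "psi b = 1" "th b = 0"
  proof -
    have "Y \<notin> span {X, Z}"
    proof
      assume "Y \<in> span {X, Z}"
      then have "span {X, Z} = span {X, Y, Z}"
        by (metis insert_commute span_redundant)
      then have "dim {X, Z} = 3" using X(4) by (metis dim_span)
      moreover have "dim {X, Z} \<le> 2"
        using dim_le_card[of "{X, Z}" "{X, Z}"] by (simp add: span_superset card_insert_if split: if_splits)
      ultimately show False by simp
    qed
    then have "Y \<notin> span {Z, X, T}"
      using notin_span_insert_T[of "{X, Z}" Y] X Y Z by (simp add: insert_commute)
    then obtain b where "phi Z Y b = 1" "phi Z X b = 0" "phi Z T b = 0"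
      using dual_vector[of Z Y "{X, T}"] Z(2) by auto
    then show ?thesis
      using that[of b] phi_skew(1)[of T Z b] by (simp add: gam_def psi_def th_def)
  qed
  obtain c where c: "gam c = 0" "psi c = 0" "th c = 1"
  proof -
    have "X \<notin> span {Z, Y, T}"
      using notin_span_insert_T[of "{Y, Z}" X] X Y Z by (simp add: insert_commute)
    then obtain c where "phi Z X c = 1" "phi Z Y c = 0" "phi Z T c = 0"
      using dual_vector[of Z X "{Y, T}"] Z(2) by auto
    then show ?thesis
      using that[of c] phi_skew(1)[of T Z c] by (simp add: gam_def psi_def th_def)
  qed
  define K where "K = {u. gam u = 0 \<and> psi u = 0 \<and> th u = 0}"
  have subK: "subspace K"
    unfolding K_def subspace_def using lin by (auto simp: linear_0 linear_add linear_scale)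
  have "M = K"
  proof (rule subspace_dim_equal[OF subspace_M subK])
    show "M \<subseteq> K" using gamM psiM thM by (auto simp: K_def)
    have sK: "span K = K" using subK by (simp add: span_eq_iff)
    have 1: "a \<notin> span K" using a unfolding sK by (simp add: K_def)
    have 2: "b \<notin> span (insert a K)"
    proof
      assume "b \<in> span (insert a K)"
      then obtain s where "b - s *\<^sub>R a \<in> K" unfolding span_breakdown_eq sK by blast
      then show False using a b lin by (simp add: K_def linear_diff linear_scale)
    qed
    have 3: "c \<notin> span (insert b (insert a K))"
    proof
      assume "c \<in> span (insert b (insert a K))"
      then obtain r s where "c - r *\<^sub>R b - s *\<^sub>R a \<in> K" unfolding span_breakdown_eq sK by blast
      then show False using a b c lin by (simp add: K_def linear_diff linear_scale)
    qed
    have "dim K + 3 = dim (insert c (insert b (insert a K)))" using 1 2 3 by (simp add: dim_insert)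
    also have "\<dots> \<le> 7" using dim_subset_UNIV dim7 by metis
    finally show "dim K \<le> dim M" using dim_M d by simp
  qed
  have expand: "f u = gam u * f a + psi u * f b + th u * f c"
    if f: "linear f" "\<And>m. m \<in> M \<Longrightarrow> f m = 0" for f :: "'a \<Rightarrow> real" and u
  proof -
    have "u - gam u *\<^sub>R a - psi u *\<^sub>R b - th u *\<^sub>R c \<in> M"
      unfolding \<open>M = K\<close> K_def using a b c lin by (simp add: linear_diff linear_scale)
    then have "f (u - gam u *\<^sub>R a - psi u *\<^sub>R b - th u *\<^sub>R c) = 0" by (rule f(2))
    then show ?thesis using f(1) by (simp add: linear_diff linear_scale)
  qed
  have lamM: "lam m = 0" if "m \<in> M" for m
  proof (rule vanishes_on_MI[OF lam(1) _ _ that])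
    show "lam T = 0" using lam(2)[of T] Z(2) by simp
    fix u v
    have "lam (br u v) *\<^sub>R Z = br (br Y u) v + br u (br Y v)"
      using lam(2)[of "br u v"] jacobi_derivation[of Y u v] by simp
    also have "\<dots> = 0" using Z(3) brZ by (simp add: lam(2))
    finally show "lam (br u v) = 0" using Z(2) by simp
  qed
  have TX: "tau T = 0 \<and> xi T = 0"
    using tx(3)[of T] by (intro coeff_unique2[OF Z(2) Y(2)]) simp
  have txbr: "tau (br u v) = 0 \<and> xi (br u v) = tau u * lam v - tau v * lam u" for u v
  proof (rule coeff_unique2[OF Z(2) Y(2)])
    have "tau (br u v) *\<^sub>R Y + xi (br u v) *\<^sub>R Z = br (br X u) v + br u (br X v)"
      using jacobi_derivation[of X u v] by (simp add: tx(3)[symmetric])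
    also have "\<dots> = 0 *\<^sub>R Y + (tau u * lam v - tau v * lam u) *\<^sub>R Z"
      by (simp add: tx(3) Z(3) brZ lam(2) brY' algebra_simps)
    finally show "tau (br u v) *\<^sub>R Y + xi (br u v) *\<^sub>R Z = 0 *\<^sub>R Y + (tau u * lam v - tau v * lam u) *\<^sub>R Z" .
  qed
  have tauM: "tau m = 0" if "m \<in> M" for m
    using vanishes_on_MI[OF tx(1) _ _ that] TX txbr by simp
  have xiD: "xi x = 0" if "x \<in> derived" for x
  proof (rule D0[OF tx(2) _ _ _ that])
    have "tau X = 0 \<and> xi X = 0"
      using tx(3)[of X] by (intro coeff_unique2[OF Z(2) Y(2)]) simp
    then show "xi X = 0" by simp
    have "tau Y = 0 \<and> xi Y = 0"
      using tx(3)[of Y] brY'[of X] lamM[OF derived_sub_M[OF X(1)]]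
      by (intro coeff_unique2[OF Z(2) Y(2)]) simp
    then show "xi Y = 0" by simp
    have "tau Z = 0 \<and> xi Z = 0"
      using tx(3)[of Z] brZ[of X] by (intro coeff_unique2[OF Z(2) Y(2)]) simp
    then show "xi Z = 0" by simp
  qed
  have xiM: "xi m = 0" if "m \<in> M" for m
    using vanishes_on_MI[OF tx(2) _ _ that] TX xiD by simp
  \<comment> \<open>\<xi> and \<theta> vanish on derived elements; the first fact makes \<tau> and
    \<lambda> proportional by Jacobi, the second makes \<tau> and \<psi> proportional by
    closedness.\<close>
  have tl: "tau u * lam v = tau v * lam u" for u v
    using txbr[of u v] xiD[of "br u v"] by simp
  have tp: "tau u * psi v = tau v * psi u" for u v
    using phi_central_br[OF Z(3), of X u v] thD[of "br u v"] by (simp add: tx(3) psi_def th_def)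
  have tau_eq: "tau u = tau b * psi u" for u using tp[of u b] b by simp
  have "\<exists>x y z. br u v = x *\<^sub>R X + y *\<^sub>R Y + z *\<^sub>R Z" for u v
  proof -
    have "br u v \<in> span {X, Y, Z}" using br_in_derived D by simp
    then obtain x y where "br u v - x *\<^sub>R X - y *\<^sub>R Y \<in> span {Z}" unfolding span_breakdown_eq[of _ X] span_breakdown_eq[of _ Y] by blast
    then obtain z where "br u v - x *\<^sub>R X - y *\<^sub>R Y = z *\<^sub>R Z" by (auto simp: span_singleton)
    then have "br u v = x *\<^sub>R X + y *\<^sub>R Y + z *\<^sub>R Z" by (simp add: algebra_simps)
    then show ?thesis by blast
  qed
  then obtain x y z where xyz: "\<And>u v. br u v = x u v *\<^sub>R X + y u v *\<^sub>R Y + z u v *\<^sub>R Z" by metis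
  \<comment> \<open>\<phi>(T, Y, \<cdot>) and \<phi>(T, X, \<cdot>) determine the coefficients x and
    y of a bracket only up to the factor \<open>p\<close>. As \<open>p\<close> may be 0, the
    relations are kept multiplied by it.\<close>
  define p where "p = phi T Y X"
  define be where "be = phi T Y"
  have TYZ: "phi T Y Z = 0" "phi T X Z = 0" "phi T X Y = - p"
    using gamM[OF derived_sub_M[OF Y(1)]] gamM[OF derived_sub_M[OF X(1)]]
      phi_skew(2)[of T Y Z] phi_skew(2)[of T X Z] phi_skew(2)[of T X Y] by (simp_all add: gam_def p_def)
  have px: "p * x u v = lam u * gam v - lam v * gam u" for u v
  proof -
    have "phi T Y (br u v) = p * x u v" using TYZ by (subst xyz) (simp add: p_def)
    then show ?thesis using phi_central_br[OF T_central, of Y u v] by (simp add: lam(2) gam_def)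
  qed
  have py: "- (p * y u v) = tau u * be v + xi u * gam v - tau v * be u - xi v * gam u" for u v
  proof -
    have "phi T X (br u v) = - (p * y u v)" using TYZ by (subst xyz) simp
    then show ?thesis using phi_central_br[OF T_central, of X u v] by (simp add: tx(3) gam_def be_def)
  qed
  have bru: "br w (br u v) = (- (x u v * tau w)) *\<^sub>R Y + (- (x u v * xi w) - y u v * lam w) *\<^sub>R Z" for u v w
    by (subst xyz) (simp add: brX' brY' brZ algebra_simps)
  have jac: "x b c * xi a + x c a * xi b + x a b * xi c + y b c * lam a + y c a * lam b + y a b * lam c = 0"
  proof -
    let ?A = "- (x b c * tau a) - x c a * tau b - x a b * tau c"
    let ?B = "- (x b c * xi a) - y b c * lam a - x c a * xi b - y c a * lam b - x a b * xi c - y a b * lam c"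
    have "?A *\<^sub>R Y + ?B *\<^sub>R Z = br a (br b c) + br b (br c a) + br c (br a b)"
      unfolding bru by (simp add: algebra_simps)
    then have "?A *\<^sub>R Y + ?B *\<^sub>R Z = 0 *\<^sub>R Y + 0 *\<^sub>R Z" using jacobi[of a b c] by simp
    then have "?B = 0" using coeff_unique2[OF Z(2) Y(2)] by blast
    then show ?thesis by linarith
  qed
  have "tau b = 0"
  proof (rule ccontr)
    assume t: "tau b \<noteq> 0"
    have lam_eq: "lam v = lam b * psi v" for v
      using tl[of b v] tau_eq[of v] t by simp
    show False
    proof (cases "lam b = 0")
      case True
      then have brY0: "br Y u = 0" for u using lam(2)[of u] lam_eq[of u] by simp
      have YXD: "phi Y X m = 0" if "m \<in> derived" for m
      proof (rule D0[OF linear_phi _ _ _ that])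
        show "phi Y X Z = 0"
          using psiM[OF derived_sub_M[OF X(1)]] phi_rotate[of Z Y X] by (simp add: psi_def)
      qed simp_all
      have "xi u * psi v = xi v * psi u" for u v
        using phi_central_br[OF brY0, of X u v] YXD[of "br u v"] phi_skew(1)[of Y Z]
        by (simp add: tx(3) psi_def)
      then have xi_eq: "xi u = xi b * psi u" for u using b by (metis mult.right_neutral)
      \<comment> \<open>Here \<tau> and \<xi> are both multiples of \<psi>, so [X, u] = \<psi>(u)Z'.
        In \<open>central_of_two_central_directions\<close> Z and Z' are the central directions and
        X plays the part of Y, which contradicts \<psi>(b) = 1.\<close>
      define Z' where "Z' = tau b *\<^sub>R Y + xi b *\<^sub>R Z"
      have "psi b = 0"
      proof (rule central_of_two_central_directions[of Z X Z'])
        show "Z' \<in> derived"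
          unfolding Z'_def using Y(1) Z(1) subspace_derived by (intro subspace_add subspace_scale)
        show "Z' \<noteq> 0"
        proof
          assume "Z' = 0"
          then have "tau b = 0 \<and> xi b = 0"
            by (intro coeff_unique2[OF Z(2) Y(2)]) (simp add: Z'_def)
          then show False using t by simp
        qed
        show "Z \<notin> span {Z'}"
        proof
          assume "Z \<in> span {Z'}"
          then obtain r where "Z = r *\<^sub>R Z'" by (auto simp: span_singleton)
          then have "0 = r * tau b \<and> 1 = r * xi b"
            by (intro coeff_unique2[OF Z(2) Y(2)]) (simp add: Z'_def scaleR_add_right)
          then show False using t by auto
        qed
        show "f w = 0" if "linear f" "f Z = 0" "f X = 0" "f Z' = 0" "w \<in> derived" for f :: "'a \<Rightarrow> real" and w
        proof (rule D0[OF that(1) that(3) _ that(2,5)])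
          show "f Y = 0" using that(1,2,4) t by (simp add: Z'_def linear_add linear_scale)
        qed
        show "br Z' u = 0" for u by (simp add: Z'_def brY0 Z(3))
        show "br X u = psi u *\<^sub>R Z'" for u
          using tx(3)[of u] tau_eq[of u] xi_eq[of u] by (simp add: Z'_def scaleR_add_right mult.commute)
      qed (use X Z in auto)
      then show False using b by simp
    next
      case False
      have l: "lam a = 0" "lam c = 0" "tau a = 0" "tau c = 0"
        using lam_eq[of a] lam_eq[of c] tau_eq[of a] tau_eq[of c] a c by simp_all
      have x0: "p * x b c = 0" "p * x c a = 0" "p * x a b = - lam b"
        using px[of b c] px[of c a] px[of a b] l a b c by simp_all
      have y0: "p * y c a = - xi c" "p * y a c = xi c"
        using py[of c a] py[of a c] l a c by simp_all
      have "p * x b c * xi a + p * x c a * xi b + p * x a b * xi c + p * y c a * lam b = 0"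
        using arg_cong[OF jac, of "\<lambda>r. p * r"] l by (simp add: algebra_simps)
      then have "- lam b * xi c - xi c * lam b = 0" unfolding x0 y0 by simp
      then have xc: "xi c = 0" using False by simp
      \<comment> \<open>The Jacobi identity has given \<xi>(c) = 0; closedness on Z, a, b, c now
        equates x(a, b) with y(a, c), and multiplying by \<open>p\<close> turns this into
        -\<lambda>(b) = \<xi>(c).\<close>
      have "phi Z a (br b c) = phi Z (br a b) c - phi Z (br a c) b" by (rule phi_central_br[OF Z(3)])
      moreover have "phi Z a (br b c) = 0"
        using a phi_skew(2)[of Z a X] phi_skew(2)[of Z a Y]
        by (subst xyz) (simp add: psi_def th_def)
      moreover have "phi Z (br a b) c = x a b"
        using c by (subst xyz) (simp add: psi_def th_def)
      moreover have "phi Z (br a c) b = y a c"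
        using b by (subst xyz) (simp add: psi_def th_def)
      ultimately have "x a b = y a c" by simp
      then have "- lam b = 0" using x0(3) y0(2) xc by simp
      then show False using False by simp
    qed
  qed
  then have tau0: "tau u = 0" for u using tau_eq[of u] by simp
  have brX: "br X u = xi u *\<^sub>R Z" for u using tx(3) tau0 by simp
  have x0: "p * x b c = 0" "p * x c a = lam c" "p * x a b = - lam b"
    using px[of b c] px[of c a] px[of a b] a b c by simp_all
  have y0: "p * y b c = 0" "p * y c a = - xi c" "p * y a b = xi b"
    using py[of b c] py[of c a] py[of a b] a b c tau0 by simp_all
  have "p * x b c * xi a + p * x c a * xi b + p * x a b * xi c + p * y b c * lam a + p * y c a * lam b + p * y a b * lam c = 0"
    using arg_cong[OF jac, of "\<lambda>r. p * r"] by (simp add: algebra_simps)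
  then have lx: "lam c * xi b = lam b * xi c" unfolding x0 y0 by (simp add: mult.commute)
  \<comment> \<open>Such a combination of \<lambda> and \<xi> is a multiple of \<gamma>, so
    \<phi>(T, al Y + bt X, \<cdot>) kills all brackets. Evaluating it at X and Y gives the two
    products.\<close>
  have pz: "p * al = 0 \<and> p * bt = 0"
    if "al * lam b + bt * xi b = 0" "al * lam c + bt * xi c = 0" for al bt
  proof -
    have e: "al * lam u + bt * xi u = gam u * (al * lam a + bt * xi a)" for u
    proof -
      have "al * lam u + bt * xi u = gam u * (al * lam a + bt * xi a) + psi u * (al * lam b + bt * xi b)
          + th u * (al * lam c + bt * xi c)"
        by (subst expand[OF lam(1) lamM, of u], simp, subst expand[OF tx(2) xiM, of u], simp, simp add: algebra_simps)
      then show ?thesis using that by simp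
    qed
    have "phi T (al *\<^sub>R Y + bt *\<^sub>R X) (br u v) = 0" for u v
    proof -
      have "phi T (al *\<^sub>R Y + bt *\<^sub>R X) (br u v) = (al * lam u + bt * xi u) * gam v - (al * lam v + bt * xi v) * gam u"
        unfolding phi_central_br[OF T_central] by (simp add: lam(2) brX gam_def algebra_simps)
      then show ?thesis unfolding e[of u] e[of v] by simp
    qed
    then have "phi T (al *\<^sub>R Y + bt *\<^sub>R X) w = 0" if "w \<in> derived" for w
      using linear_vanishes_on_derived[OF linear_phi _ that] by blast
    then have "phi T (al *\<^sub>R Y + bt *\<^sub>R X) X = 0" "phi T (al *\<^sub>R Y + bt *\<^sub>R X) Y = 0" using X Y by blast+
    then show ?thesis using TYZ by (simp add: p_def mult.commute)
  qed
  \<comment> \<open>For p = 0 the relations \<open>x0\<close> and \<open>y0\<close> already say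
    this. Otherwise \<open>lx\<close> makes the values of (\<lambda>, \<xi>) at b and c
    proportional, so a combination vanishing at one of them vanishes at both.\<close>
  have z: "lam b = 0 \<and> lam c = 0 \<and> xi b = 0 \<and> xi c = 0"
  proof (cases "p = 0")
    case True
    then show ?thesis using x0 y0 by simp
  next
    case False
    then show ?thesis
      using pz[of "xi b" "- lam b"] pz[of "xi c" "- lam c"] lx by (simp add: mult.commute)
  qed
  have lam_eq: "lam u = lam a * gam u" and xi_eq: "xi u = xi a * gam u" for u
    using expand[OF lam(1) lamM, of u] expand[OF tx(2) xiM, of u] z by simp_all
  have la: "lam a = 0"
  proof (rule ccontr)
    assume la: "lam a \<noteq> 0"
    \<comment> \<open>As \<lambda> and \<xi> are both multiples of \<gamma>, this combination of X
      and Y is central.\<close>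
    define X0 where "X0 = lam a *\<^sub>R X - xi a *\<^sub>R Y"
    have "lam a = 0"
    proof (rule central_of_two_central_directions[of X0 Y Z])
      show "X0 \<in> derived"
        unfolding X0_def using X(1) Y(1) subspace_derived by (intro subspace_diff subspace_scale)
      show "X0 \<notin> span {Z}"
      proof
        assume "X0 \<in> span {Z}"
        then obtain r where "X0 = r *\<^sub>R Z" by (auto simp: span_singleton)
        then have "lam a *\<^sub>R X = xi a *\<^sub>R Y + r *\<^sub>R Z" by (simp add: X0_def algebra_simps)
        then have "lam a *\<^sub>R X \<in> span {Y, Z}" by (simp add: span_add span_base span_scale)
        from span_scale[OF this, of "1 / lam a"] show False using la X(2) by simp
      qed
      show "f w = 0" if "linear f" "f X0 = 0" "f Y = 0" "f Z = 0" "w \<in> derived" for f :: "'a \<Rightarrow> real" and w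
      proof (rule D0[OF that(1) _ that(3,4,5)])
        show "f X = 0" using that(1,2,3) la by (simp add: X0_def linear_diff linear_scale)
      qed
      show "br X0 u = 0" for u
        using lam_eq[of u] xi_eq[of u] by (simp add: X0_def brX lam(2) mult.commute)
    qed (use X Y Z lam in auto)
    then show False using la by simp
  qed
  have brY0: "br Y u = 0" for u using lam(2) lam_eq[of u] la by simp
  have "xi u = 0" for u
    by (rule central_of_two_central_directions[of Y X Z])
      (use X Y Z brX brY0 D0 in auto)
  then have brX0: "br X u = 0" for u using brX by simp
  have "(\<lambda>w. br w u) w = 0" if "w \<in> derived" for w
    using linear_eq_0_on_span[OF linear_br(2) _ that[unfolded D]] brX0 brY0 Z(3) by auto
  then show ?thesis using W by simp
qed

subsection \<open>Recognition of the models\<close>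

lemma derived_0_model0:
  assumes "dim derived = 0"
  shows "lie_iso br model0"
proof -
  have "br x y = 0" for x y
    using assms br_in_derived[of x y] unfolding dim_eq_0 by blast
  moreover obtain e :: "nat \<Rightarrow> 'a" where "bij_betw e {1..7} Basis"
    using ex_bij_betw_nat_finite_1[of "Basis :: 'a set"] dim7 by auto
  then have "span (e ` {1..7}) = UNIV" by (simp add: bij_betw_def)
  ultimately show ?thesis
    unfolding model0_def by (intro lie_iso_lie_of_d[OF dim7 lie]) simp_all
qed

lemma exists_notin_span:
  fixes S :: "'a set"
  assumes "dim S < 7"
  shows "\<exists>x. x \<notin> span S"
  using assms dim_span[of S] dim7 by (metis UNIV_eq_I dim_UNIV less_irrefl)

text \<open>M is central of codimension 3, so all brackets come from three vectors a, b, c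
  completing it. The algebra is the free 2-step nilpotent one on three generators plus the line of
  T. Only spanning is checked; dimension 7 makes it a basis.\<close>

lemma derived_3_model2:
  assumes d: "dim derived = 3"
  shows "lie_iso br model2"
proof -
  have cen: "br (br x y) z = 0" "br z (br x y) = 0" for x y z
    using dim_derived_3_central[OF d br_in_derived] br_skew[of z "br x y"] by simp_all
  obtain a where a: "a \<notin> span M" using exists_notin_span[of M] dim_M d by auto
  obtain b where b: "b \<notin> span (insert a M)"
    using exists_notin_span[of "insert a M"] a dim_M d by (auto simp: dim_insert)
  obtain c where c: "c \<notin> span (insert b (insert a M))"
    using exists_notin_span[of "insert b (insert a M)"] a b dim_M d by (auto simp: dim_insert)
  have "dim (insert c (insert b (insert a M))) = 7"
    using a b c dim_M d by (simp add: dim_insert)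
  then have U: "span (insert c (insert b (insert a M))) = UNIV"
    using dim7 by (metis dim_eq_full)
  have brM: "br m u = 0" if "m \<in> M" for m u
  proof -
    have "br x u = 0" if "x \<in> insert T derived" for x
      using that dim_derived_3_central[OF d] by auto
    then show ?thesis
      using linear_eq_0_on_span[OF linear_br(2) _ \<open>m \<in> M\<close>[unfolded M_def]] by blast
  qed
  then have brM': "br u m = 0" if "m \<in> M" for m u using that br_skew[of u m] by simp
  have dec: "\<exists>r s t m. m \<in> M \<and> u = r *\<^sub>R a + s *\<^sub>R b + t *\<^sub>R c + m" for u
  proof -
    have "u \<in> span (insert c (insert b (insert a M)))" using U by simp
    then obtain t s r where "u - t *\<^sub>R c - s *\<^sub>R b - r *\<^sub>R a \<in> span M"
      unfolding span_breakdown_eq by blast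
    then have "u - t *\<^sub>R c - s *\<^sub>R b - r *\<^sub>R a \<in> M" using subspace_M by (metis span_eq_iff)
    then show ?thesis
      by (intro exI[of _ r] exI[of _ s] exI[of _ t] exI[of _ "u - t *\<^sub>R c - s *\<^sub>R b - r *\<^sub>R a"]) simp
  qed
  \<comment> \<open>Position 0 is a dummy. The signs reflect that de^4 = e^12 means [e_1, e_2] =
    -e_4.\<close>
  define e where "e = (\<lambda>i. [0, a, b, c, - br a b, - br a c, - br b c, T] ! i)"
  let ?E = "span {a, b, c, - br a b, - br a c, - br b c, T}"
  have E: "e ` {1..7} = {a, b, c, - br a b, - br a c, - br b c, T}"
    unfolding atLeastAtMost_1_7 by (simp add: e_def del: One_nat_def)
  have neg: "x \<in> ?E" if "- x \<in> {a, b, c, - br a b, - br a c, - br b c, T}" for x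
    using span_neg[OF span_base[OF that]] by simp
  have brE: "br u v \<in> ?E" for u v
  proof -
    obtain r s t m where u: "m \<in> M" "u = r *\<^sub>R a + s *\<^sub>R b + t *\<^sub>R c + m" using dec by blast
    obtain r' s' t' m' where v: "m' \<in> M" "v = r' *\<^sub>R a + s' *\<^sub>R b + t' *\<^sub>R c + m'" using dec by blast
    have "br u v = (r * s' - s * r') *\<^sub>R br a b + (r * t' - t * r') *\<^sub>R br a c + (s * t' - t * s') *\<^sub>R br b c"
      using br_skew[of b a] br_skew[of c a] br_skew[of c b] brM[OF u(1)] brM'[OF v(1)]
      by (simp add: u(2) v(2) algebra_simps)
    moreover have "br a b \<in> ?E" "br a c \<in> ?E" "br b c \<in> ?E" by (simp_all add: neg)
    ultimately show ?thesis by (simp add: span_add span_scale)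
  qed
  have "derived \<subseteq> ?E" using brE by (intro derived_subset) simp_all
  moreover have "T \<in> ?E" "a \<in> ?E" "b \<in> ?E" "c \<in> ?E" by (simp_all add: span_base)
  ultimately have "M \<subseteq> ?E" unfolding M_def by (intro span_minimal) simp_all
  then have "span (insert c (insert b (insert a M))) \<subseteq> ?E"
    using \<open>a \<in> ?E\<close> \<open>b \<in> ?E\<close> \<open>c \<in> ?E\<close> by (intro span_minimal) simp_all
  then have gen: "span (e ` {1..7}) = UNIV" unfolding E using U by auto
  show ?thesis
    unfolding model2_def
  proof (rule lie_iso_lie_of_d[OF dim7 lie gen])
    fix i j :: nat assume ij: "i \<in> {1..7}" "j \<in> {1..7}" "i < j"
    show "br (e i) (e j) = - (\<Sum>k = 1..7.
        (of_bool ((k, i, j) = (4, 1, 2) \<or> (k, i, j) = (5, 1, 3) \<or> (k, i, j) = (6, 2, 3))) *\<^sub>R e k)"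
      using ij unfolding atLeastAtMost_1_7 sum_1_7
      by (elim insertE emptyE; simp add: e_def cen del: One_nat_def)
  qed
qed

text \<open>Closedness of \<phi>(Z, \<cdot>, \<cdot>) and \<phi>(Y, \<cdot>, \<cdot>) makes the
  kernel of \<phi>(Z, Y, \<cdot>) abelian. The whole bracket is then the action of one vector w
  outside this hyperplane, and that action maps onto the derived plane.\<close>

lemma derived_2_model1:
  assumes d: "dim derived = 2"
  shows "lie_iso br model1"
proof -
  obtain Y Z where YZ: "Z \<noteq> 0" "Y \<notin> span {Z}" "derived = span {Y, Z}" "\<And>x. br Y x = 0" "\<And>x. br Z x = 0"
    using dim_derived_2_central[OF d] by metis
  have inD: "Y \<in> derived" "Z \<in> derived" using YZ(3) by (simp_all add: span_base)
  have brYZ: "br x Y = 0" "br x Z = 0" for x using YZ(4,5) br_skew[of x] by simp_all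
  define kap where "kap = phi Z Y"
  have lin: "linear kap" by (simp add: kap_def linear_phi)
  have kapM: "kap m = 0" if "m \<in> M" for m
    using phi_ZY_M[OF YZ(5) inD(1) _ that] YZ(4) by (simp add: kap_def span_0)
  obtain w where w: "kap w = 1"
    using dual_vector[of Z Y "{}"] YZ(1,2) by (auto simp: kap_def)
  have coef: "\<exists>y z. x = y *\<^sub>R Y + z *\<^sub>R Z" if x: "x \<in> derived" for x
  proof -
    obtain y where "x - y *\<^sub>R Y \<in> span {Z}"
      using x unfolding YZ(3) span_breakdown_eq[of _ Y] by blast
    then obtain z where "x - y *\<^sub>R Y = z *\<^sub>R Z" by (auto simp: span_singleton)
    then show ?thesis by (metis add.commute diff_add_cancel)
  qed
  have abel: "br m n = 0" if mn: "kap m = 0" "kap n = 0" for m n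
  proof -
    obtain y z where yz: "br m n = y *\<^sub>R Y + z *\<^sub>R Z" using coef[OF br_in_derived] by blast
    obtain y' z' where yz': "br n w = y' *\<^sub>R Y + z' *\<^sub>R Z" using coef[OF br_in_derived] by blast
    obtain y'' z'' where yz'': "br m w = y'' *\<^sub>R Y + z'' *\<^sub>R Z" using coef[OF br_in_derived] by blast
    have k: "phi Z Y m = 0" "phi Z Y n = 0" "phi Z m Y = 0" "phi Y Z n = 0" "phi Y m Z = 0"
        "phi Z Y w = 1" "phi Y Z w = - 1"
      using mn w phi_skew(2)[of Z m Y] phi_skew(1)[of Y Z n] phi_skew(2)[of Y m Z] phi_skew(1)[of Y Z m] phi_skew(1)[of Y Z w]
      by (simp_all add: kap_def)
    have "y = 0"
      using phi_central_br[OF YZ(5), of m n w] k by (simp add: yz yz' yz'')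
    moreover have "z = 0"
      using phi_central_br[OF YZ(4), of m n w] k by (simp add: yz yz' yz'')
    ultimately show ?thesis using yz by simp
  qed
  have "derived \<subseteq> range (br w)"
  proof (rule derived_subset)
    show "subspace (range (br w))" by (simp add: linear_br linear_subspace_image)
    fix u v
    have "br (u - kap u *\<^sub>R w) (v - kap v *\<^sub>R w) = 0"
      using lin w by (intro abel) (simp_all add: linear_diff linear_scale)
    then have "br u v = br w (kap u *\<^sub>R v - kap v *\<^sub>R u)"
      using br_skew[of u w] by (simp add: algebra_simps)
    then show "br u v \<in> range (br w)" by blast
  qed
  then obtain n2 n3 where n: "Y = br w n2" "Z = br w n3" using inD by blast
  define e2 where "e2 = n2 - kap n2 *\<^sub>R w"
  define e3 where "e3 = n3 - kap n3 *\<^sub>R w"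
  have e2: "kap e2 = 0" "br w e2 = Y" and e3: "kap e3 = 0" "br w e3 = Z"
    using lin w n by (simp_all add: e2_def e3_def linear_diff linear_scale)
  have "br w x = 0" if "x \<in> {T, Y, Z}" for x using that brYZ by auto
  then have ker: "br w x = 0" if "x \<in> span {T, Y, Z}" for x
    using linear_eq_0_on_span[OF linear_br(1) _ that] by blast
  have 1: "T \<notin> span {Y, Z}" using T_not_derived YZ(3) by simp
  have 2: "e2 \<notin> span {T, Y, Z}" using ker[of e2] e2 YZ(2) by (auto simp: span_0)
  have 3: "e3 \<notin> span {e2, T, Y, Z}"
  proof
    assume "e3 \<in> span {e2, T, Y, Z}"
    then obtain k where "e3 - k *\<^sub>R e2 \<in> span {T, Y, Z}" unfolding span_breakdown_eq[of _ e2] by blast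
    from ker[OF this] have "0 *\<^sub>R Y + 1 *\<^sub>R Z = k *\<^sub>R Y + 0 *\<^sub>R Z" using e2 e3 by simp
    then show False using coeff_unique2[OF YZ(1,2)] by (metis zero_neq_one)
  qed
  have 4: "w \<notin> span {e3, e2, T, Y, Z}"
  proof
    assume "w \<in> span {e3, e2, T, Y, Z}"
    moreover have "kap x = 0" if "x \<in> {e3, e2, T, Y, Z}" for x
      using that e2 e3 kapM T_in_M derived_sub_M inD by auto
    ultimately have "kap w = 0" using linear_eq_0_on_span[OF lin] by blast
    then show False using w by simp
  qed
  have dYZ: "dim {Y, Z} = 2" using YZ(3) d by (metis dim_span)
  have d6: "dim {w, e3, e2, T, Y, Z} = 6"
    unfolding dim_insert[of w] dim_insert[of e3] dim_insert[of e2] dim_insert[of T] using 1 2 3 4 dYZ by simp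
  then obtain v where v: "v \<notin> span {w, e3, e2, T, Y, Z}"
    using exists_notin_span[of "{w, e3, e2, T, Y, Z}"] by auto
  obtain y z where yz: "br w v = y *\<^sub>R Y + z *\<^sub>R Z" using coef[OF br_in_derived] by blast
  \<comment> \<open>Subtracting the w-part puts v into the kernel of \<open>kap\<close>; subtracting
    preimages of the Y- and Z-parts of [w, v] makes it commute with w.\<close>
  define e4 where "e4 = v - (kap v *\<^sub>R w + y *\<^sub>R e2 + z *\<^sub>R e3)"
  have e4: "kap e4 = 0" "br w e4 = 0"
    using lin w e2 e3 yz by (simp_all add: e4_def linear_diff linear_add linear_scale)
  have e4n: "e4 \<notin> span {w, e3, e2, T, Y, Z}"
  proof
    assume "e4 \<in> span {w, e3, e2, T, Y, Z}"
    moreover have "kap v *\<^sub>R w + y *\<^sub>R e2 + z *\<^sub>R e3 \<in> span {w, e3, e2, T, Y, Z}"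
      by (intro span_add span_scale span_base) simp_all
    ultimately have "e4 + (kap v *\<^sub>R w + y *\<^sub>R e2 + z *\<^sub>R e3) \<in> span {w, e3, e2, T, Y, Z}" by (rule span_add)
    then show False using v by (simp add: e4_def)
  qed
  have "dim {e4, w, e3, e2, T, Y, Z} = 7" using e4n d6 by (simp add: dim_insert[of e4])
  then have U: "span {e4, w, e3, e2, T, Y, Z} = UNIV" using dim7 by (metis dim_eq_full)
  define e where "e = (\<lambda>i. [0, w, e2, e3, e4, - Y, - Z, T] ! i)"
  have E: "e ` {1..7} = {w, e2, e3, e4, - Y, - Z, T}"
    unfolding atLeastAtMost_1_7 by (simp add: e_def del: One_nat_def)
  have "x \<in> span (e ` {1..7})" if "x \<in> {e4, w, e3, e2, T, Y, Z}" for x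
  proof (cases "x \<in> {Y, Z}")
    case True
    then have "- x \<in> span (e ` {1..7})" unfolding E by (intro span_base) auto
    then show ?thesis using span_neg by fastforce
  next
    case False
    then show ?thesis unfolding E using that by (intro span_base) auto
  qed
  then have "span {e4, w, e3, e2, T, Y, Z} \<subseteq> span (e ` {1..7})" by (intro span_minimal) auto
  then have gen: "span (e ` {1..7}) = UNIV" using U by auto
  have ab: "br e2 e3 = 0" "br e2 e4 = 0" "br e3 e4 = 0" using abel e2 e3 e4 by blast+
  show ?thesis
    unfolding model1_def
  proof (rule lie_iso_lie_of_d[OF dim7 lie gen])
    fix i j :: nat assume ij: "i \<in> {1..7}" "j \<in> {1..7}" "i < j"
    show "br (e i) (e j) = - (\<Sum>k = 1..7.
        (of_bool ((k, i, j) = (5, 1, 2) \<or> (k, i, j) = (6, 1, 3))) *\<^sub>R e k)"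
      using ij unfolding atLeastAtMost_1_7 sum_1_7
      by (elim insertE emptyE; simp add: e_def ab e2 e3 e4 brYZ YZ(4,5) del: One_nat_def)
  qed
qed

lemma lie_iso_model: "lie_iso br model0 \<or> lie_iso br model1 \<or> lie_iso br model2"
proof -
  have "dim derived \<in> {0, 2, 3}"
    using dim_derived_le_4 dim_derived_ne_4 dim_derived_ne_1 by force
  then show ?thesis using derived_0_model0 derived_2_model1 derived_3_model2 by blast
qed

end

theorem theorem3p1:
  fixes br :: "'a::euclidean_space \<Rightarrow> 'a \<Rightarrow> 'a"
  assumes "DIM('a) = 7"
    and "lie_algebra br"
    and "nilpotent_lie br"
    and "decomposable_lie br"
  shows "has_calibrated_G2 br \<longleftrightarrow>
           (lie_iso br model0 \<or> lie_iso br model1 \<or> lie_iso br model2)"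
proof
  assume "has_calibrated_G2 br"
  then obtain \<phi> where "G2_structure \<phi>" "\<And>a b c e. ce_d3 br \<phi> a b c e = 0"
    unfolding has_calibrated_G2_def by blast
  then interpret calibrated_lie br \<phi> using assms by unfold_locales
  obtain T where "\<And>x. br T x = 0" "T \<notin> derived"
    using exists_central_not_derived[OF assms(4)] by blast
  then interpret calibrated_lie_central br \<phi> T by unfold_locales
  show "lie_iso br model0 \<or> lie_iso br model1 \<or> lie_iso br model2" by (rule lie_iso_model)
next
  assume "lie_iso br model0 \<or> lie_iso br model1 \<or> lie_iso br model2"
  then show "has_calibrated_G2 br"
    using has_calibrated_G2_pullback has_calibrated_G2_model0 has_calibrated_G2_model1
      has_calibrated_G2_model2 by blast
qed

end
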